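(* Let $d\ge 3$ be an integer and let $k$ be a field with $\mathrm{char}\,k=0$ or $\mathrm{char}\,k>d$. (i) If $\varphi$ is a strongly multiplicative nondegenerate diagonal form of degree $d$ over $k$, then $\varphi\cong\langle 1\rangle$. (ii) If $\varphi$ is a strongly multiplicative nondegenerate separable form of degree $d$ over $k$, then $\varphi\cong\langle 1\rangle$.
   Context: A form of degree $d$ on a (nonzero) finite-dimensional $k$-vector space $V$ is a map $\varphi:V\to k$ which in coordinates is given by a homogeneous polynomial of degree $d$ over $k$; it corresponds to a unique symmetric $d$-linear form $\theta$ with $\varphi(v)=\theta(v,\dots,v)$, and it is nondegenerate if $v=0$ is the only vector with $\theta(v,v_2,\dots,v_d)=0$ for all $v_i\in V$. Two forms of degree $d$ are isomorphic ($\cong$) if they correspond to each other under a bijective linear map of the underlying spaces. $\langle a_1,\dots,a_n\rangle$ denotes the form $a_1x_1^d+\dots+a_nx_n^d$; a form which can be written this way (after a linear change of coordinates) is called diagonal. In particular $\langle1\rangle$ is the one-dimensional form $x_1^d$. A form is separable if it becomes isomorphic to a diagonal form over the algebraic closure of $k$. With $n=\dim V$, $X=(x_1,\dots,x_n)$ independent indeterminates, $K=k(X)$ and $\varphi(X)\in K$ the generic value of $\varphi$, $\varphi$ is strongly multiplicative if $\varphi(X)\varphi_K\cong\varphi_K$ over $K$. *)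

theory Defs
  imports
    "HOL-Analysis.Analysis"
    "HOL-Library.Poly_Mapping"
    "HOL-Computational_Algebra.Fraction_Field"
    "HOL-Algebra.Algebraic_Closure_Type"
begin

text \<open>
  A vector space over \<open>'k\<close> is a type \<open>'v\<close> with a scalar multiplication
  \<open>sc :: 'k \<Rightarrow> 'v \<Rightarrow> 'v\<close>. A family \<open>b :: 'n \<Rightarrow> 'v\<close> whose range is a basis provides coordinates,
  where the finite type \<open>'n\<close> plays the role of \<open>{1,\<dots>,n}\<close>, \<open>n = dim V\<close>. Types are nonempty,
  so \<open>V\<close> is nonzero.
\<close>

subsection \<open>Polynomials in the variables \<open>x\<^sub>i\<close>, \<open>i :: 'n\<close>\<close>

type_synonym ('n, 'k) mpoly = "('n \<Rightarrow>\<^sub>0 nat) \<Rightarrow>\<^sub>0 'k"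

definition mpoly_eval :: "('n::finite, 'k::field) mpoly \<Rightarrow> 'k ^ 'n \<Rightarrow> 'k" where
  "mpoly_eval p x = (\<Sum>m\<in>Poly_Mapping.keys p.
     Poly_Mapping.lookup p m * (\<Prod>i\<in>UNIV. x $ i ^ Poly_Mapping.lookup m i))"

definition homogeneous :: "nat \<Rightarrow> ('n::finite, 'k::field) mpoly \<Rightarrow> bool" where
  "homogeneous d p \<longleftrightarrow>
     (\<forall>m\<in>Poly_Mapping.keys p. (\<Sum>i\<in>UNIV. Poly_Mapping.lookup m i) = d)"

subsection \<open>Forms of degree \<open>d\<close>\<close>

definition in_coords ::
  "('k::field \<Rightarrow> 'v::ab_group_add \<Rightarrow> 'v) \<Rightarrow> ('n::finite \<Rightarrow> 'v) \<Rightarrow> ('v \<Rightarrow> 'k) \<Rightarrow> 'k ^ 'n \<Rightarrow> 'k" where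
  "in_coords sc b \<phi> x = \<phi> (\<Sum>i\<in>UNIV. sc (x $ i) (b i))"

definition is_form ::
  "('k::field \<Rightarrow> 'v::ab_group_add \<Rightarrow> 'v) \<Rightarrow> ('n::finite \<Rightarrow> 'v) \<Rightarrow> nat \<Rightarrow> ('v \<Rightarrow> 'k) \<Rightarrow> bool" where
  "is_form sc b d \<phi> \<longleftrightarrow>
     (\<exists>p :: ('n, 'k) mpoly. homogeneous d p \<and> in_coords sc b \<phi> = mpoly_eval p)"

text \<open>
  Symmetric \<open>d\<close>-linear forms are functions on lists of vectors; only their values on lists
  of length \<open>d\<close> matter.
\<close>

definition symmetric_multilinear ::
  "('k::field \<Rightarrow> 'v::ab_group_add \<Rightarrow> 'v) \<Rightarrow> nat \<Rightarrow> ('v list \<Rightarrow> 'k) \<Rightarrow> bool" where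
  "symmetric_multilinear sc d \<theta> \<longleftrightarrow>
     (\<forall>us ws. length us + length ws + 1 = d \<longrightarrow>
        Vector_Spaces.linear sc (*) (\<lambda>v. \<theta> (us @ v # ws))) \<and>
     (\<forall>us ws. length us = d \<longrightarrow> mset us = mset ws \<longrightarrow> \<theta> us = \<theta> ws)"

text \<open>
  If the characteristic is \<open>0\<close> or greater than \<open>d\<close>, then the form \<open>\<theta>\<close> below exists and is unique
  on lists of length \<open>d\<close>, for every form \<open>\<phi>\<close> of degree \<open>d\<close>.
\<close>

definition nondegenerate ::
  "('k::field \<Rightarrow> 'v::ab_group_add \<Rightarrow> 'v) \<Rightarrow> nat \<Rightarrow> ('v \<Rightarrow> 'k) \<Rightarrow> bool" where
  "nondegenerate sc d \<phi> \<longleftrightarrow>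
     (\<exists>\<theta>. symmetric_multilinear sc d \<theta> \<and>
          (\<forall>v. \<phi> v = \<theta> (replicate d v)) \<and>
          (\<forall>v. (\<forall>ws. length ws = d - 1 \<longrightarrow> \<theta> (v # ws) = 0) \<longrightarrow> v = 0))"

definition isomorphic_forms ::
  "('k::field \<Rightarrow> 'v::ab_group_add \<Rightarrow> 'v) \<Rightarrow> ('v \<Rightarrow> 'k) \<Rightarrow>
   ('k \<Rightarrow> 'w::ab_group_add \<Rightarrow> 'w) \<Rightarrow> ('w \<Rightarrow> 'k) \<Rightarrow> bool" where
  "isomorphic_forms sc \<phi> sc' \<psi> \<longleftrightarrow>
     (\<exists>f. Vector_Spaces.linear sc sc' f \<and> bij f \<and> (\<forall>v. \<psi> (f v) = \<phi> v))"

definition diag_form :: "nat \<Rightarrow> ('n::finite \<Rightarrow> 'k::field) \<Rightarrow> 'k ^ 'n \<Rightarrow> 'k" where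
  "diag_form d a x = (\<Sum>i\<in>UNIV. a i * x $ i ^ d)"

definition unit_form :: "nat \<Rightarrow> 'k::field ^ 1 \<Rightarrow> 'k" where
  "unit_form d = diag_form d (\<lambda>_. 1)"

definition is_diagonal ::
  "'n::finite itself \<Rightarrow> ('k::field \<Rightarrow> 'v::ab_group_add \<Rightarrow> 'v) \<Rightarrow> nat \<Rightarrow> ('v \<Rightarrow> 'k) \<Rightarrow> bool" where
  "is_diagonal _ sc d \<phi> \<longleftrightarrow>
     (\<exists>a :: 'n \<Rightarrow> 'k. isomorphic_forms sc \<phi> (*s) (diag_form d a))"

subsection \<open>Base change\<close>

text \<open>
  The homogeneous polynomial representing a form in the coordinates given by \<open>b\<close> is unique if
  the characteristic is \<open>0\<close> or greater than \<open>d\<close>: then \<open>'k\<close> has more than \<open>d\<close> elements. The base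
  change of \<open>\<phi>\<close> along a field embedding \<open>\<iota>\<close> from \<open>'k\<close> into \<open>'l\<close> is the form on
  \<open>'l ^ 'n\<close>, that is, on \<open>V \<otimes> 'l\<close> in the coordinates given by \<open>b\<close>, defined by the same polynomial.
\<close>

definition form_poly ::
  "('k::field \<Rightarrow> 'v::ab_group_add \<Rightarrow> 'v) \<Rightarrow> ('n::finite \<Rightarrow> 'v) \<Rightarrow> nat \<Rightarrow> ('v \<Rightarrow> 'k) \<Rightarrow> ('n, 'k) mpoly" where
  "form_poly sc b d \<phi> = (THE p. homogeneous d p \<and> in_coords sc b \<phi> = mpoly_eval p)"

definition base_change ::
  "('k::field \<Rightarrow> 'l::field) \<Rightarrow> ('k \<Rightarrow> 'v::ab_group_add \<Rightarrow> 'v) \<Rightarrow> ('n::finite \<Rightarrow> 'v) \<Rightarrow> nat \<Rightarrow>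
   ('v \<Rightarrow> 'k) \<Rightarrow> 'l ^ 'n \<Rightarrow> 'l" where
  "base_change \<iota> sc b d \<phi> = mpoly_eval (Poly_Mapping.map \<iota> (form_poly sc b d \<phi>))"

definition is_separable ::
  "('k::field \<Rightarrow> 'v::ab_group_add \<Rightarrow> 'v) \<Rightarrow> ('n::finite \<Rightarrow> 'v) \<Rightarrow> nat \<Rightarrow> ('v \<Rightarrow> 'k) \<Rightarrow> bool" where
  "is_separable sc b d \<phi> \<longleftrightarrow> is_diagonal TYPE('n) (*s) d (base_change to_ac sc b d \<phi>)"

subsection \<open>The rational function field and strongly multiplicative forms\<close>

text \<open>
  The library shows that a polynomial ring is an integral domain only if the set of variables
  carries a linear order, hence the sort constraint on \<open>'n\<close>. The order is not used otherwise.
\<close>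

type_synonym ('n, 'k) ratfun = "('n, 'k) mpoly fract"

definition ratfun_const :: "'k::field \<Rightarrow> ('n::{finite,linorder}, 'k) ratfun" where
  "ratfun_const c = Fract (Poly_Mapping.single 0 c) 1"

definition generic_vector :: "(('n::{finite,linorder}, 'k::field) ratfun, 'n) vec" where
  "generic_vector = (\<chi> i. Fract (Poly_Mapping.single (Poly_Mapping.single i 1) 1) 1)"

definition strongly_multiplicative ::
  "('k::field \<Rightarrow> 'v::ab_group_add \<Rightarrow> 'v) \<Rightarrow> ('n::{finite,linorder} \<Rightarrow> 'v) \<Rightarrow> nat \<Rightarrow>
   ('v \<Rightarrow> 'k) \<Rightarrow> bool" where
  "strongly_multiplicative sc b d \<phi> \<longleftrightarrow>
     (let \<phi>\<^sub>K = base_change (ratfun_const :: 'k \<Rightarrow> ('n, 'k) ratfun) sc b d \<phi>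
      in isomorphic_forms (*s) (\<lambda>x. \<phi>\<^sub>K generic_vector * \<phi>\<^sub>K x) (*s) \<phi>\<^sub>K)"

end

theory Submission
  imports Defs "HOL-Number_Theory.Cong"
begin

text \<open>
  Strong multiplicativity says that over \<open>K = k(X)\<close> there is a matrix \<open>M\<close> with
  \<open>\<phi>(M y) = \<phi>(X) \<phi>(y)\<close>. Clearing denominators, \<open>M = N / c\<close>, gives a polynomial identity
  \<open>\<phi>(N y) = c\<^sup>d \<phi>(X) \<phi>(y)\<close> (\<open>strongly_multiplicative_identity\<close>), which can be evaluated at points over
  the algebraic closure of \<open>k\<close>. A diagonal form becomes diagonal there as well, so both parts of the
  theorem start from a separable form.

  The form remains nondegenerate over the closure (\<open>nondegenerate_after_extension\<close>), so it is
  \<open>\<Sum>\<^sub>i a\<^sub>i x\<^sub>i\<^sup>d\<close> with nonzero \<open>a\<^sub>i\<close> in suitable coordinates. For \<open>d \<ge> 3\<close> a linear map that multiplies such a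
  form by a nonzero scalar \<open>s\<close> has a monomial matrix
  (\<open>similarity_of_diag_form_monomial\<close>); hence \<open>a\<^sub>i N\<^sub>i\<^sub>j\<^sup>d = s a\<^sub>j\<close> for some \<open>j\<close>. With
  \<open>s = c\<^sup>d \<phi>(X)\<close> it follows that \<open>\<phi>(X)\<close> is a constant times a \<open>d\<close>-th power of a rational function. If there
  are at least two variables, this contradicts the existence of a line on which \<open>\<phi>\<close> has a simple root
  (\<open>multiplicative_diag_form_dim_1\<close>). So the dimension is one.

  Then \<open>\<phi> = A x\<^sup>d\<close> over \<open>k\<close> itself, and the isomorphism \<open>\<phi>(X) \<phi>\<^sub>K \<cong> \<phi>\<^sub>K\<close> says that \<open>A X\<^sup>d\<close> is a \<open>d\<close>-th
  power in \<open>K\<close>; comparing leading coefficients, \<open>A\<close> is a \<open>d\<close>-th power in \<open>k\<close>, that is,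
  \<open>\<phi> \<cong> \<langle>1\<rangle>\<close> (\<open>one_dimensional_isomorphic_unit_form\<close>).
\<close>

(* From here on, smult is scalar multiplication of univariate polynomials. *)
hide_const (open) Module.smult

section \<open>Evaluation of polynomials through ring homomorphisms\<close>

locale unital_ring_hom =
  fixes h :: "'a::comm_ring_1 \<Rightarrow> 'b::comm_ring_1"
  assumes add: "h (x + y) = h x + h y"
    and mult: "h (x * y) = h x * h y"
    and one: "h 1 = 1"
begin

lemma zero: "h 0 = 0"
  using add[of 0 0] by simp

lemma sum: "h (\<Sum>i\<in>A. f i) = (\<Sum>i\<in>A. h (f i))"
  by (induction A rule: infinite_finite_induct) (simp_all add: zero add)

lemma prod: "h (\<Prod>i\<in>A. f i) = (\<Prod>i\<in>A. h (f i))"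
  by (induction A rule: infinite_finite_induct) (simp_all add: one mult)

lemma power: "h (x ^ n) = h x ^ n"
  by (induction n) (simp_all add: one mult)

lemma of_nat: "h (of_nat n) = of_nat n"
  by (induction n) (simp_all add: one zero add)

end

text \<open>
  A single notion of evaluation serves several targets of a ring homomorphism \<open>h\<close>: the base field, its
  algebraic closure, the field of rational functions, the ring of multivariate polynomials
  (substitution), and the univariate polynomials.
\<close>

definition peval :: "('k::comm_ring_1 \<Rightarrow> 'r::comm_ring_1) \<Rightarrow> ('n::finite \<Rightarrow> 'r) \<Rightarrow>
    (('n \<Rightarrow>\<^sub>0 nat) \<Rightarrow>\<^sub>0 'k) \<Rightarrow> 'r" where
  "peval h x p = (\<Sum>m\<in>Poly_Mapping.keys p.
     h (Poly_Mapping.lookup p m) * (\<Prod>i\<in>UNIV. x i ^ Poly_Mapping.lookup m i))"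

lemma poly_mapping_sum_single:
  "p = (\<Sum>m\<in>Poly_Mapping.keys p. Poly_Mapping.single m (Poly_Mapping.lookup p m))"
  by (rule poly_mapping_eqI)
    (auto simp: lookup_sum lookup_single when_def in_keys_iff sum.delta)

context unital_ring_hom
begin

lemma peval_superset:
  assumes "finite A" "Poly_Mapping.keys p \<subseteq> A"
  shows "peval h x p = (\<Sum>m\<in>A. h (Poly_Mapping.lookup p m) *
    (\<Prod>i\<in>UNIV. x i ^ Poly_Mapping.lookup m i))"
  unfolding peval_def using assms
  by (intro sum.mono_neutral_left) (auto simp: in_keys_iff zero)

lemma peval_add: "peval h x (p + q) = peval h x p + peval h x q"
proof -
  let ?A = "Poly_Mapping.keys p \<union> Poly_Mapping.keys q"
  have "Poly_Mapping.keys (p + q) \<subseteq> ?A"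
    by (rule keys_add)
  then have "peval h x (p + q) = (\<Sum>m\<in>?A. h (Poly_Mapping.lookup (p + q) m) *
      (\<Prod>i\<in>UNIV. x i ^ Poly_Mapping.lookup m i))"
    by (intro peval_superset) auto
  also have "\<dots> = peval h x p + peval h x q"
    by (subst (1 2) peval_superset[of ?A])
      (auto simp: lookup_add add sum.distrib algebra_simps)
  finally show ?thesis .
qed

lemma peval_sum: "peval h x (\<Sum>i\<in>A. f i) = (\<Sum>i\<in>A. peval h x (f i))"
proof (induction A rule: infinite_finite_induct)
  case (insert a A)
  then show ?case by (simp add: peval_add)
qed (simp_all add: peval_def)

lemma peval_single:
  "peval h x (Poly_Mapping.single m c) = h c * (\<Prod>i\<in>UNIV. x i ^ Poly_Mapping.lookup m i)"
  by (simp add: peval_def zero)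

lemma peval_mult: "peval h x (p * q) = peval h x p * peval h x q"
proof -
  let ?c = Poly_Mapping.lookup and ?s = Poly_Mapping.single
  have "p * q = (\<Sum>m\<in>Poly_Mapping.keys p. ?s m (?c p m)) * (\<Sum>n\<in>Poly_Mapping.keys q. ?s n (?c q n))"
    using poly_mapping_sum_single[of p] poly_mapping_sum_single[of q] by simp
  also have "\<dots> = (\<Sum>m\<in>Poly_Mapping.keys p. \<Sum>n\<in>Poly_Mapping.keys q. ?s (m + n) (?c p m * ?c q n))"
    by (simp add: sum_product mult_single)
  finally show ?thesis
    by (simp add: peval_sum peval_single mult lookup_add power_add prod.distrib
        peval_def[of h x p] peval_def[of h x q] sum_product mult_ac)
qed

lemma unital_ring_hom_peval: "unital_ring_hom (peval h x)"
proof
  show "peval h x 1 = 1"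
    using peval_single[of x 0 1] by (simp add: one)
qed (simp_all add: peval_add peval_mult)

lemma hom_peval:
  "h (peval g x p) = peval (\<lambda>c. h (g c)) (\<lambda>i. h (x i)) p"
  by (simp add: peval_def sum mult prod power)

end

lemma mpoly_eval_peval: "mpoly_eval p x = peval (\<lambda>c. c) (\<lambda>i. x $ i) p"
  by (simp add: mpoly_eval_def peval_def)

lemma keys_map_inj:
  assumes "\<And>c. h c = 0 \<longleftrightarrow> c = 0"
  shows "Poly_Mapping.keys (Poly_Mapping.map h p) = Poly_Mapping.keys p"
proof (rule Set.set_eqI)
  fix m
  show "m \<in> Poly_Mapping.keys (Poly_Mapping.map h p) \<longleftrightarrow> m \<in> Poly_Mapping.keys p"
    unfolding in_keys_iff Poly_Mapping.map.rep_eq when_def using assms[of "Poly_Mapping.lookup p m"] by simp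
qed

lemma mpoly_eval_map:
  assumes "\<And>c. h c = 0 \<longleftrightarrow> c = 0"
  shows "mpoly_eval (Poly_Mapping.map h p) x = peval h (\<lambda>i. x $ i) p"
  unfolding mpoly_eval_def peval_def keys_map_inj[OF assms]
  by (intro sum.cong refl) (simp add: Poly_Mapping.map.rep_eq when_def in_keys_iff)

lemma peval_scale:
  assumes "homogeneous d p"
  shows "peval h (\<lambda>i. c * x i) p = c ^ d * peval h x p"
proof -
  have "(\<Prod>i\<in>UNIV. (c * x i) ^ Poly_Mapping.lookup m i) =
      c ^ d * (\<Prod>i\<in>UNIV. x i ^ Poly_Mapping.lookup m i)"
    if "m \<in> Poly_Mapping.keys p" for m
  proof -
    have "(\<Sum>i\<in>UNIV. Poly_Mapping.lookup m i) = d"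
      using assms that by (auto simp: homogeneous_def)
    then show ?thesis
      by (simp only: power_mult_distrib prod.distrib power_sum[symmetric])
  qed
  then have "peval h (\<lambda>i. c * x i) p = (\<Sum>m\<in>Poly_Mapping.keys p. c ^ d *
      (h (Poly_Mapping.lookup p m) * (\<Prod>i\<in>UNIV. x i ^ Poly_Mapping.lookup m i)))"
    unfolding peval_def by (intro sum.cong refl) (simp only: mult.left_commute)
  then show ?thesis
    by (simp only: peval_def sum_distrib_left)
qed

section \<open>Functions that are polynomial on lines\<close>

text \<open>
  Pulling back to lines reduces statements about polynomial functions in many variables to
  univariate polynomials. The class contains the functions \<open>peval h (\<lambda>i. x $ i) p\<close> and is closed under
  composition with linear maps, so changes of coordinates need no computation with coefficients.
\<close>

definition poly_on_lines :: "nat \<Rightarrow> ('l::field ^ 'n \<Rightarrow> 'l) \<Rightarrow> bool" where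
  "poly_on_lines d F \<longleftrightarrow>
     (\<forall>u v. \<exists>q. Polynomial.degree q \<le> d \<and> (\<forall>t. F (u + t *s v) = poly q t))"

lemma poly_on_linesE:
  assumes "poly_on_lines d F"
  obtains q where "Polynomial.degree q \<le> d" "\<And>t. F (u + t *s v) = poly q t"
  using assms unfolding poly_on_lines_def by meson

lemma poly_on_lines_const: "poly_on_lines d (\<lambda>_. c)"
  unfolding poly_on_lines_def by (auto intro!: exI[of _ "[:c:]"])

lemma poly_on_lines_coord: "poly_on_lines 1 (\<lambda>x. x $ i)"
  unfolding poly_on_lines_def
proof (intro allI)
  fix u v :: "'a ^ 'b"
  show "\<exists>q. Polynomial.degree q \<le> 1 \<and> (\<forall>t. (u + t *s v) $ i = poly q t)"
    by (intro exI[of _ "[:u $ i, v $ i:]"]) simp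
qed

lemma poly_on_lines_add:
  assumes "poly_on_lines d F" "poly_on_lines d G"
  shows "poly_on_lines d (\<lambda>x. F x + G x)"
  unfolding poly_on_lines_def
proof (intro allI)
  fix u v
  obtain p q where "Polynomial.degree p \<le> d" "\<And>t. F (u + t *s v) = poly p t"
    "Polynomial.degree q \<le> d" "\<And>t. G (u + t *s v) = poly q t"
    using assms by (metis poly_on_linesE)
  then show "\<exists>q. Polynomial.degree q \<le> d \<and> (\<forall>t. F (u + t *s v) + G (u + t *s v) = poly q t)"
    by (intro exI[of _ "p + q"]) (auto intro: degree_add_le)
qed

lemma poly_on_lines_mult:
  assumes "poly_on_lines d F" "poly_on_lines e G"
  shows "poly_on_lines (d + e) (\<lambda>x. F x * G x)"
  unfolding poly_on_lines_def
proof (intro allI)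
  fix u v
  obtain p q where "Polynomial.degree p \<le> d" "\<And>t. F (u + t *s v) = poly p t"
    "Polynomial.degree q \<le> e" "\<And>t. G (u + t *s v) = poly q t"
    using assms by (metis poly_on_linesE)
  then show "\<exists>q. Polynomial.degree q \<le> d + e \<and> (\<forall>t. F (u + t *s v) * G (u + t *s v) = poly q t)"
    by (intro exI[of _ "p * q"]) (auto intro: order_trans[OF degree_mult_le] add_mono)
qed

lemma poly_on_lines_cmult: "poly_on_lines d F \<Longrightarrow> poly_on_lines d (\<lambda>x. c * F x)"
  using poly_on_lines_mult[OF poly_on_lines_const[of 0 c]] by simp

lemma poly_on_lines_mono: "poly_on_lines d F \<Longrightarrow> d \<le> e \<Longrightarrow> poly_on_lines e F"
  unfolding poly_on_lines_def by (meson order_trans)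

lemma poly_on_lines_diff:
  "poly_on_lines d F \<Longrightarrow> poly_on_lines d G \<Longrightarrow> poly_on_lines d (\<lambda>x. F x - G x)"
  using poly_on_lines_add[of d F "\<lambda>x. -1 * G x"] poly_on_lines_cmult[of d G "-1"] by simp

lemma poly_on_lines_sum:
  "(\<And>i. i \<in> A \<Longrightarrow> poly_on_lines d (F i)) \<Longrightarrow> poly_on_lines d (\<lambda>x. \<Sum>i\<in>A. F i x)"
  by (induction A rule: infinite_finite_induct)
    (simp_all add: poly_on_lines_const poly_on_lines_add)

lemma poly_on_lines_power: "poly_on_lines d F \<Longrightarrow> poly_on_lines (n * d) (\<lambda>x. F x ^ n)"
  by (induction n) (simp_all add: poly_on_lines_const poly_on_lines_mult)

lemma poly_on_lines_prod:
  "(\<And>i. i \<in> A \<Longrightarrow> poly_on_lines (e i) (F i)) \<Longrightarrow>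
    poly_on_lines (\<Sum>i\<in>A. e i) (\<lambda>x. \<Prod>i\<in>A. F i x)"
  by (induction A rule: infinite_finite_induct)
    (simp_all add: poly_on_lines_const poly_on_lines_mult)

lemma poly_on_lines_comp_linear:
  assumes "poly_on_lines d F" "Vector_Spaces.linear (*s) (*s) g"
  shows "poly_on_lines d (\<lambda>x. F (g x))"
  unfolding poly_on_lines_def
proof (intro allI)
  fix u v
  obtain q where "Polynomial.degree q \<le> d" "\<And>t. F (g u + t *s g v) = poly q t"
    using assms(1) by (metis poly_on_linesE)
  then show "\<exists>q. Polynomial.degree q \<le> d \<and> (\<forall>t. F (g (u + t *s v)) = poly q t)"
    using vec.linear_add[OF assms(2)] vec.linear_scale[OF assms(2)] by auto
qed

lemma poly_on_lines_peval:
  assumes "\<And>m. m \<in> Poly_Mapping.keys p \<Longrightarrow> (\<Sum>i\<in>UNIV. Poly_Mapping.lookup m i) \<le> d"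
  shows "poly_on_lines d (\<lambda>x. peval h (\<lambda>i. x $ i) p)"
  unfolding peval_def
proof (intro poly_on_lines_sum poly_on_lines_cmult)
  fix m assume m: "m \<in> Poly_Mapping.keys p"
  have "poly_on_lines (\<Sum>i\<in>UNIV. Poly_Mapping.lookup m i * 1)
      (\<lambda>x. \<Prod>i\<in>UNIV. x $ i ^ Poly_Mapping.lookup m i)"
    by (intro poly_on_lines_prod poly_on_lines_power poly_on_lines_coord)
  then show "poly_on_lines d (\<lambda>x. \<Prod>i\<in>UNIV. x $ i ^ Poly_Mapping.lookup m i)"
    using assms[OF m] by (auto intro: poly_on_lines_mono)
qed

lemma ex_poly_on_lines_peval: "\<exists>d. poly_on_lines d (\<lambda>x. peval h (\<lambda>i. x $ i) p)"
proof
  show "poly_on_lines (\<Sum>m\<in>Poly_Mapping.keys p. \<Sum>i\<in>UNIV. Poly_Mapping.lookup m i)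
      (\<lambda>x. peval h (\<lambda>i. x $ i) p)"
    by (intro poly_on_lines_peval
        member_le_sum[where f = "\<lambda>m. \<Sum>i\<in>UNIV. Poly_Mapping.lookup m i"]) auto
qed

lemma ex_poly_on_lines_sum:
  assumes "finite A" "\<And>i. i \<in> A \<Longrightarrow> \<exists>e. poly_on_lines e (F i)"
  shows "\<exists>e. poly_on_lines e (\<lambda>x. \<Sum>i\<in>A. F i x)"
proof -
  obtain e where e: "\<And>i. i \<in> A \<Longrightarrow> poly_on_lines (e i) (F i)" using assms(2) by metis
  have "poly_on_lines (sum e A) (F i)" if "i \<in> A" for i
    using e[OF that] that assms(1) by (auto intro: poly_on_lines_mono member_le_sum)
  then show ?thesis by (blast intro: poly_on_lines_sum)
qed

lemma poly_eq_0_if_many_roots: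
  fixes q :: "'a::idom poly"
  assumes "Polynomial.degree q \<le> d" "infinite S \<or> card S > d" "\<And>t. t \<in> S \<Longrightarrow> poly q t = 0"
  shows "q = 0"
proof (rule ccontr)
  assume "q \<noteq> 0"
  then have "finite {t. poly q t = 0}" "card {t. poly q t = 0} \<le> Polynomial.degree q"
    using poly_roots_finite card_poly_roots_bound by auto
  moreover have "S \<subseteq> {t. poly q t = 0}"
    using assms(3) by auto
  ultimately show False
    using assms(1,2) by (meson card_mono finite_subset leD order_trans)
qed

text \<open>
  A polynomial identity of degree at most \<open>d\<close> may thus be checked on a grid, in particular on
  vectors with coordinates in a subfield with more than \<open>d\<close> elements. The coordinates are freed
  from \<open>S\<close> one at a time: on a line parallel to the axis of the next one there are too many roots.
\<close>

lemma poly_on_lines_vanish: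
  fixes F :: "'l::field ^ 'n \<Rightarrow> 'l"
  assumes F: "poly_on_lines d F" and S: "infinite S \<or> card S > d"
    and zero: "\<And>x. (\<And>i. x $ i \<in> S) \<Longrightarrow> F x = 0"
  shows "F x = 0"
proof -
  have "\<forall>x. (\<forall>i. i \<notin> A \<longrightarrow> x $ i \<in> S) \<longrightarrow> F x = 0" for A :: "'n set"
  proof -
    have "finite A" by simp
    then show ?thesis
    proof (induction A)
      case empty
      then show ?case using zero by auto
    next
      case (insert a A)
      show ?case
      proof (intro allI impI)
        fix x :: "'l ^ 'n" assume x: "\<forall>i. i \<notin> insert a A \<longrightarrow> x $ i \<in> S"
        define u where "u = (\<chi> i. if i = a then 0 else x $ i)"
        obtain q where q: "Polynomial.degree q \<le> d" "\<And>t. F (u + t *s axis a 1) = poly q t"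
          using F by (rule poly_on_linesE) blast
        have "poly q t = 0" if "t \<in> S" for t
        proof -
          have "\<forall>i. i \<notin> A \<longrightarrow> (u + t *s axis a 1) $ i \<in> S"
            using that x by (auto simp: u_def axis_def)
          then show ?thesis using insert.IH q(2) by metis
        qed
        then have "q = 0" using poly_eq_0_if_many_roots[OF q(1) S] by blast
        moreover have "x = u + (x $ a) *s axis a 1"
          by (auto simp: vec_eq_iff u_def axis_def)
        ultimately show "F x = 0" using q(2) by (metis poly_0)
      qed
    qed
  qed
  from this[of UNIV] show ?thesis by simp
qed

text \<open>
  On the line that joins a nonzero of \<open>F\<close> to a nonzero of \<open>G\<close>, neither function vanishes
  identically, so their product has only finitely many zeros there.
\<close>

lemma poly_on_lines_common_nonzero:
  fixes F G :: "'l::field ^ 'n \<Rightarrow> 'l"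
  assumes "infinite (UNIV :: 'l set)" "poly_on_lines d F" "poly_on_lines e G"
    and "F u \<noteq> 0" "G v \<noteq> 0"
  obtains w where "F w \<noteq> 0" "G w \<noteq> 0"
proof -
  obtain p where p: "\<And>t. F (u + t *s (v - u)) = poly p t"
    using assms(2) by (metis poly_on_linesE)
  obtain q where q: "\<And>t. G (u + t *s (v - u)) = poly q t"
    using assms(3) by (metis poly_on_linesE)
  have "p \<noteq> 0" using p[of 0] assms(4) by auto
  moreover have "q \<noteq> 0" using q[of 1] assms(5) by auto
  ultimately have "finite {t. poly (p * q) t = 0}"
    by (intro poly_roots_finite) auto
  then obtain t where "t \<notin> {t. poly (p * q) t = 0}"
    using assms(1) ex_new_if_finite by blast
  then have "poly (p * q) t \<noteq> 0" by simp
  then show ?thesis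
    using that[of "u + t *s (v - u)"] p q by auto
qed

text \<open>
  Reading off coefficients one variable at a time. Restricting the products to a set \<open>A\<close> of variables
  makes monomials that agree on \<open>A\<close> indistinguishable, so the induction yields the sums of
  the coefficients over such classes; for the set of all variables the classes are singletons.
\<close>

lemma monomial_coeffs_zero:
  fixes c :: "('n \<Rightarrow>\<^sub>0 nat) \<Rightarrow> 'l::field"
  assumes S: "infinite S \<or> card S > d"
    and "finite A" "finite E" and "\<And>m i. m \<in> E \<Longrightarrow> Poly_Mapping.lookup m i \<le> d"
    and "\<And>x. (\<And>i. x i \<in> S) \<Longrightarrow> (\<Sum>m\<in>E. c m * (\<Prod>i\<in>A. x i ^ Poly_Mapping.lookup m i)) = 0"
  shows "(\<Sum>m\<in>{m\<in>E. \<forall>i\<in>A. Poly_Mapping.lookup m i = e i}. c m) = 0"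
  using assms(2-)
proof (induction A arbitrary: E)
  case empty
  obtain s where "s \<in> S" using S by (metis card.empty finite.emptyI less_nat_zero_code ex_in_conv)
  then show ?case using empty.prems(3)[of "\<lambda>_. s"] by simp
next
  case (insert a A)
  let ?l = Poly_Mapping.lookup
  define E' where "E' j = {m\<in>E. ?l m a = j}" for j
  have fin: "finite (E' j)" for j using insert.prems by (simp add: E'_def)
  have "(\<Sum>m\<in>E' j. c m * (\<Prod>i\<in>A. x i ^ ?l m i)) = 0" if x: "\<And>i. x i \<in> S" for x j
  proof -
    define q where "q = (\<Sum>m\<in>E. Polynomial.monom (c m * (\<Prod>i\<in>A. x i ^ ?l m i)) (?l m a))"
    have "Polynomial.degree q \<le> d"
      unfolding q_def using insert.prems(1,2)
      by (intro degree_sum_le) (auto intro: order_trans[OF degree_monom_le])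
    moreover have "poly q t = 0" if "t \<in> S" for t
    proof -
      have "(\<Prod>i\<in>A. (x(a := t)) i ^ ?l m i) = (\<Prod>i\<in>A. x i ^ ?l m i)" for m
        using insert.hyps by (intro prod.cong) auto
      then have "poly q t = (\<Sum>m\<in>E. c m * (\<Prod>i\<in>insert a A. (x(a := t)) i ^ ?l m i))"
        using insert.hyps
        by (simp add: q_def poly_sum poly_monom mult_ac del: fun_upd_apply) (simp add: mult_ac)
      also have "\<dots> = 0" using x that by (intro insert.prems(3)) auto
      finally show ?thesis .
    qed
    ultimately have "q = 0" using S by (intro poly_eq_0_if_many_roots) auto
    then have "0 = Polynomial.coeff q j" by simp
    also have "\<dots> = (\<Sum>m\<in>E. if ?l m a = j then c m * (\<Prod>i\<in>A. x i ^ ?l m i) else 0)"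
      by (simp add: q_def coeff_sum)
    also have "\<dots> = (\<Sum>m\<in>E' j. c m * (\<Prod>i\<in>A. x i ^ ?l m i))"
      unfolding E'_def using insert.prems(1) by (rule sum.inter_filter[symmetric])
    finally show ?thesis by simp
  qed
  then have "(\<Sum>m\<in>{m\<in>E' (e a). \<forall>i\<in>A. ?l m i = e i}. c m) = 0"
    using insert.prems(2) by (intro insert.IH fin) (auto simp: E'_def)
  moreover have "{m\<in>E' (e a). \<forall>i\<in>A. ?l m i = e i} = {m\<in>E. \<forall>i\<in>insert a A. ?l m i = e i}"
    by (auto simp: E'_def)
  ultimately show ?case by simp
qed

lemma peval_nonzero:
  fixes p :: "('n::finite \<Rightarrow>\<^sub>0 nat) \<Rightarrow>\<^sub>0 'k::field" and h :: "'k \<Rightarrow> 'l::field"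
  assumes "p \<noteq> 0" "\<And>c. h c = 0 \<longleftrightarrow> c = 0"
    and S: "infinite S \<or> card S > d"
    and bound: "\<And>m i. m \<in> Poly_Mapping.keys p \<Longrightarrow> Poly_Mapping.lookup m i \<le> d"
  obtains (witness) x :: "'l ^ 'n" where "\<And>i. x $ i \<in> S" "peval h (\<lambda>i. x $ i) p \<noteq> 0"
proof (rule ccontr)
  assume neg: "\<not> thesis"
  have *: "peval h (\<lambda>i. x $ i) p = 0" if "\<And>i. x $ i \<in> S" for x :: "'l ^ 'n"
    using neg witness[OF that] by blast
  obtain m where m: "m \<in> Poly_Mapping.keys p"
    using assms(1) by (metis poly_mapping_eqI lookup_zero lookup_not_eq_zero_eq_in_keys)
  have "(\<Sum>m\<in>Poly_Mapping.keys p. h (Poly_Mapping.lookup p m) *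
      (\<Prod>i\<in>UNIV. x i ^ Poly_Mapping.lookup m i)) = 0" if "\<And>i. x i \<in> S" for x
    using *[of "vec_lambda x"] that by (simp add: peval_def)
  then have "(\<Sum>m'\<in>{m'\<in>Poly_Mapping.keys p. \<forall>i\<in>UNIV. Poly_Mapping.lookup m' i =
      Poly_Mapping.lookup m i}. h (Poly_Mapping.lookup p m')) = 0"
    using S bound by (intro monomial_coeffs_zero) auto
  moreover have "{m'\<in>Poly_Mapping.keys p. \<forall>i\<in>UNIV. Poly_Mapping.lookup m' i =
      Poly_Mapping.lookup m i} = {m}"
    using m by (auto intro: poly_mapping_eqI)
  ultimately show False using m assms(2) by (simp add: in_keys_iff)
qed

lemma peval_nonzero_infinite:
  fixes p :: "('n::finite, 'k::field) mpoly" and h :: "'k \<Rightarrow> 'l::field"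
  assumes "p \<noteq> 0" "\<And>c. h c = 0 \<longleftrightarrow> c = 0" "infinite (UNIV :: 'l set)"
  obtains x :: "'l ^ 'n" where "peval h (\<lambda>i. x $ i) p \<noteq> 0"
proof -
  define D where "D = (\<Sum>m\<in>Poly_Mapping.keys p. \<Sum>i\<in>UNIV. Poly_Mapping.lookup m i)"
  have bound: "Poly_Mapping.lookup m i \<le> D" if "m \<in> Poly_Mapping.keys p" for m i
  proof -
    have "Poly_Mapping.lookup m i \<le> (\<Sum>i\<in>UNIV. Poly_Mapping.lookup m i)"
      by (rule member_le_sum) auto
    also have "\<dots> \<le> D"
      unfolding D_def using that
      by (intro member_le_sum[where f = "\<lambda>m. \<Sum>i\<in>UNIV. Poly_Mapping.lookup m i"]) auto
    finally show ?thesis .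
  qed
  show ?thesis
  proof (rule peval_nonzero[OF assms(1,2), where S = "UNIV :: 'l set" and d = D])
    show "infinite (UNIV :: 'l set) \<or> D < card (UNIV :: 'l set)" using assms(3) by simp
  qed (use bound that in auto)
qed

section \<open>Similarities of diagonal forms\<close>

text \<open>
  Over a finite field the product of all \<open>x - a\<close>, increased by \<open>1\<close>, would have no root.
\<close>

lemma infinite_UNIV_alg_closed: "infinite (UNIV :: 'l::alg_closed_field set)"
proof
  assume fin: "finite (UNIV :: 'l set)"
  define p :: "'l poly" where "p = (\<Prod>a\<in>UNIV. [:- a, 1:])"
  have root: "poly p x = 0" for x
    using fin by (auto simp: p_def poly_prod)
  have "p \<noteq> 0" using fin by (simp add: p_def)
  then have "Polynomial.degree p \<noteq> 0"
    using root by (metis degree_eq_zeroE mult_zero_right add.right_neutral pCons_0_0 poly_pCons poly_0)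
  then have "Polynomial.degree (p + 1) > 0"
    by (simp add: degree_add_eq_left)
  then obtain x where "poly (p + 1) x = 0"
    using alg_closed_imp_poly_has_root by blast
  then show False using root by simp
qed

lemma pderiv_sum: "pderiv (\<Sum>i\<in>A. f i) = (\<Sum>i\<in>A. pderiv (f i))"
  by (induction A rule: infinite_finite_induct) (simp_all add: pderiv_add)

lemma axis_power: "0 < d \<Longrightarrow> (axis i (1 :: 'a::comm_ring_1) $ l) ^ d = (if l = i then 1 else 0)"
  by (simp add: axis_def power_0_left)

text \<open>
  Both sides are polynomials in \<open>t\<close>; their derivatives at \<open>0\<close>, divided by \<open>e\<close>, are compared.
\<close>

lemma derivative_of_power_sum:
  fixes a b c :: "'n::finite \<Rightarrow> 'l::field"
  assumes inf: "infinite (UNIV :: 'l set)" and e: "of_nat e \<noteq> (0 :: 'l)"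
    and eq: "\<And>t. (\<Sum>i\<in>UNIV. a i * (b i + t * c i) ^ e) = r * (u + t * v) ^ e + C"
  shows "(\<Sum>i\<in>UNIV. a i * c i * b i ^ (e - 1)) = r * v * u ^ (e - 1)"
proof -
  define P where "P = (\<Sum>i\<in>UNIV. smult (a i) ([:b i, c i:] ^ e))"
  define Q where "Q = smult r ([:u, v:] ^ e) + [:C:]"
  have "poly (P - Q) t = 0" for t
    using eq[of t] by (simp add: P_def Q_def poly_sum mult.commute)
  then have "P - Q = 0"
    using inf by (intro poly_eq_0_if_many_roots[of _ "Polynomial.degree (P - Q)" UNIV]) auto
  then have "poly (pderiv P) 0 = poly (pderiv Q) 0" by simp
  then have "(\<Sum>i\<in>UNIV. a i * (of_nat e * (b i ^ (e - 1) * c i))) = r * (of_nat e * (u ^ (e - 1) * v))"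
    by (simp add: P_def Q_def pderiv_sum pderiv_smult pderiv_power pderiv_add pderiv_pCons poly_sum mult_ac)
  then have "of_nat e * (\<Sum>i\<in>UNIV. a i * c i * b i ^ (e - 1)) = of_nat e * (r * v * u ^ (e - 1))"
    by (simp add: sum_distrib_left mult_ac)
  then show ?thesis using e by simp
qed

lemma linear_component:
  fixes g :: "'l::field ^ 'n \<Rightarrow> 'l ^ 'm"
  assumes "Vector_Spaces.linear (*s) (*s) g"
  shows "g z $ i = (\<Sum>k\<in>UNIV. g (axis k 1) $ i * z $ k)"
proof -
  have "g z = g (\<Sum>k\<in>UNIV. (z $ k) *s axis k 1)" by (simp add: basis_expansion)
  also have "\<dots> = (\<Sum>k\<in>UNIV. (z $ k) *s g (axis k 1))"
    by (simp add: vec.linear_sum[OF assms] vec.linear_scale[OF assms])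
  finally show ?thesis by (simp add: mult.commute)
qed

text \<open>
  The rigidity of diagonal forms of degree at least \<open>3\<close>: a similarity permutes the coordinate axes
  up to scalars. Differentiating \<open>diag_form d a (T y) = s * diag_form d a y\<close> in the direction of the
  axis \<open>j\<close> and then of another axis \<open>j'\<close> kills the right-hand side and leaves
  \<open>\<Sum>\<^sub>l a\<^sub>l N\<^sub>l\<^sub>j N\<^sub>l\<^sub>j\<^sub>' (T y)\<^sub>l\<^sup>d\<^sup>-\<^sup>2 = 0\<close>. Since \<open>d - 2 > 0\<close> and \<open>T\<close> is onto, choosing \<open>T y\<close> to be the \<open>i\<close>-th
  basis vector isolates the term \<open>l = i\<close>, so row \<open>i\<close> of the matrix \<open>N\<close> of \<open>T\<close> has a single
  nonzero entry.
\<close>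

lemma similarity_of_diag_form_monomial:
  fixes a :: "'n::finite \<Rightarrow> 'l::field" and T :: "'l ^ 'n \<Rightarrow> 'l ^ 'n"
  assumes inf: "infinite (UNIV :: 'l set)"
    and d: "d \<ge> 3" "of_nat d \<noteq> (0 :: 'l)" "of_nat (d - 1) \<noteq> (0 :: 'l)"
    and a: "\<And>i. a i \<noteq> 0"
    and T: "Vector_Spaces.linear (*s) (*s) T"
    and s: "s \<noteq> 0" "\<And>y. diag_form d a (T y) = s * diag_form d a y"
  obtains j where "T (axis j 1) $ i \<noteq> 0" "a i * (T (axis j 1) $ i) ^ d = s * a j"
    "\<And>j'. j' \<noteq> j \<Longrightarrow> T (axis j' 1) $ i = 0"
proof -
  define N where "N l j = T (axis j 1) $ l" for l j
  have T_line: "T (y + t *s axis j 1) $ l = T y $ l + t * N l j" for y t j l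
    by (simp add: vec.linear_add[OF T] vec.linear_scale[OF T] N_def)
  have first: "(\<Sum>l\<in>UNIV. a l * N l j * (T y $ l) ^ (d - 1)) = s * a j * (y $ j) ^ (d - 1)" for y j
  proof -
    have "(\<Sum>l\<in>UNIV. a l * (T y $ l + t * N l j) ^ d) =
        s * a j * (y $ j + t * 1) ^ d + s * (\<Sum>l\<in>UNIV - {j}. a l * (y $ l) ^ d)" for t
    proof -
      have "(\<Sum>l\<in>UNIV. a l * (T y $ l + t * N l j) ^ d) = diag_form d a (T (y + t *s axis j 1))"
        by (simp add: diag_form_def T_line)
      also have "\<dots> = s * (\<Sum>l\<in>UNIV. a l * ((y + t *s axis j 1) $ l) ^ d)"
        by (simp only: s(2)) (simp only: diag_form_def)
      also have "\<dots> = s * a j * (y $ j + t * 1) ^ d + s * (\<Sum>l\<in>UNIV - {j}. a l * (y $ l) ^ d)"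
        by (subst sum.remove[of _ j]) (simp_all add: axis_def algebra_simps)
      finally show ?thesis .
    qed
    from derivative_of_power_sum[OF inf d(2) this] show ?thesis by simp
  qed
  have second: "(\<Sum>l\<in>UNIV. a l * N l j * N l j' * (T y $ l) ^ (d - 2)) = 0" if "j \<noteq> j'" for y j j'
  proof -
    have "(\<Sum>l\<in>UNIV. a l * N l j * (T y $ l + t * N l j') ^ (d - 1)) =
        0 * (0 + t * 0) ^ (d - 1) + s * a j * (y $ j) ^ (d - 1)" for t
      using first[of j "y + t *s axis j' 1", unfolded T_line] that by (simp add: axis_def)
    from derivative_of_power_sum[OF inf d(3) this] show ?thesis by (simp add: numeral_2_eq_2)
  qed
  have "inj T"
    unfolding vec.linear_inj_iff_eq_0[OF T]
  proof (intro allI impI)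
    fix y assume "T y = 0"
    then have "s * a j * (y $ j) ^ (d - 1) = 0" for j
      using first[of j y] d(1) by (simp add: power_0_left)
    then show "y = 0" using s(1) a by (simp add: vec_eq_iff)
  qed
  then have "surj T" by (rule vec.linear_inj_imp_surj[OF T])
  then obtain y where y: "T y = axis i 1" by (metis surjD)
  have delta: "(T y $ l) ^ (Suc n) = (if l = i then 1 else 0)" for l n
    by (simp add: y axis_def)
  have disjoint: "N i j * N i j' = 0" if "j \<noteq> j'" for j j'
  proof -
    have "d - 2 = Suc (d - 3)" using d(1) by simp
    then have "a i * N i j * N i j' = 0"
      using second[OF that, of y] by (simp only: delta) (simp add: if_distrib cong: if_cong)
    then show ?thesis using a by simp
  qed
  have exp_y: "1 = (\<Sum>j\<in>UNIV. y $ j * N i j)"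
    using linear_component[OF T, of y i] by (simp add: y axis_def N_def mult.commute)
  then obtain j where j: "N i j \<noteq> 0" by force
  then have zero: "N i j' = 0" if "j' \<noteq> j" for j' using disjoint[of j j'] that by auto
  then have yN: "y $ j * N i j = 1"
    using exp_y by (subst (asm) sum.remove[of _ j]) auto
  have "d - 1 = Suc (d - 2)" using d(1) by simp
  then have "a i * N i j = s * a j * (y $ j) ^ (d - 1)"
    using first[of j y] by (simp only: delta) (simp add: if_distrib cong: if_cong)
  then have "a i * N i j * N i j ^ (d - 1) = s * a j * (y $ j * N i j) ^ (d - 1)"
    by (simp add: power_mult_distrib)
  moreover have "N i j * N i j ^ (d - 1) = N i j ^ d"
    using d(1) by (metis Suc_diff_1 gr0I not_numeral_le_zero power_Suc)
  ultimately have "a i * N i j ^ d = s * a j"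
    using yN by (simp add: mult.assoc)
  with j zero show ?thesis by (intro that[of j]) (auto simp: N_def)
qed

lemma order_power:
  fixes p :: "'a::idom poly"
  assumes "p \<noteq> 0"
  shows "Polynomial.order x (p ^ n) = n * Polynomial.order x p"
  using assms by (induction n) (simp_all add: order_mult)

text \<open>
  The order of \<open>f\<close> at each point is a difference of multiples of \<open>d\<close>, so it cannot be \<open>1\<close>.
\<close>

lemma dth_power_multiple_has_no_simple_root:
  fixes f g h :: "'l::field poly"
  assumes "d \<ge> 2" "c \<noteq> 0" "g \<noteq> 0" "h ^ d * f = smult c (g ^ d)" "poly f x = 0"
  shows "poly (pderiv f) x = 0"
proof -
  have nz: "h ^ d * f \<noteq> 0" using assms by simp
  then have hf: "h \<noteq> 0" "f \<noteq> 0" using assms(1) by auto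
  have "Polynomial.order x (h ^ d * f) = d * Polynomial.order x h + Polynomial.order x f"
    using nz hf by (simp add: order_mult order_power)
  moreover have "Polynomial.order x (h ^ d * f) = d * Polynomial.order x g"
    using assms by (simp add: order_smult order_power)
  ultimately have "d dvd Polynomial.order x f"
    by (metis dvd_add_right_iff dvd_triv_left)
  moreover have "Polynomial.order x f > 0"
    using assms(5) hf by (simp add: order_root)
  ultimately have "Polynomial.order x f \<ge> 2" using assms(1) by (meson dvd_imp_le order_trans)
  then have "[:- x, 1:] ^ 2 dvd f" by (simp add: order_divides)
  then obtain r where "f = [:- x, 1:] ^ 2 * r" by (elim dvdE)
  then show ?thesis by (simp add: pderiv_mult pderiv_power)
qed

lemma poly_on_lines_diag_form: "poly_on_lines d (\<lambda>x. \<Sum>i\<in>A. a i * x $ i ^ d)"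
  using poly_on_lines_power[OF poly_on_lines_coord, of d]
  by (intro poly_on_lines_sum poly_on_lines_cmult) simp

text \<open>
  The core of the argument. By rigidity, wherever the similarity factor
  \<open>s u = H u ^ d * diag_form d a u\<close> is nonzero, it equals the \<open>d\<close>-th power of a matrix entry of
  \<open>T u\<close>, up to a constant. In at least two variables this is absurd: on a suitable line parallel to a
  coordinate axis, \<open>diag_form d a\<close> is a polynomial \<open>a\<^sub>i (w\<^sub>i + t)\<^sup>d + R\<close> with constant \<open>R \<noteq> 0\<close>,
  all of whose roots are simple, while \<open>s\<close> restricts to a constant times a \<open>d\<close>-th power.
\<close>

lemma multiplicative_diag_form_dim_1:
  fixes a :: "'n::finite \<Rightarrow> 'l::alg_closed_field"
    and H :: "'l ^ 'n \<Rightarrow> 'l" and T :: "'l ^ 'n \<Rightarrow> 'l ^ 'n \<Rightarrow> 'l ^ 'n"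
  assumes d: "d \<ge> 3" "of_nat d \<noteq> (0 :: 'l)" "of_nat (d - 1) \<noteq> (0 :: 'l)"
    and a: "\<And>i. a i \<noteq> 0"
    and H: "poly_on_lines e H" "H u0 \<noteq> 0"
    and T_linear: "\<And>u. Vector_Spaces.linear (*s) (*s) (T u)"
    and T_poly: "\<And>y i. \<exists>e. poly_on_lines e (\<lambda>u. T u y $ i)"
    and T: "\<And>u y. diag_form d a (T u y) = H u ^ d * diag_form d a u * diag_form d a y"
  shows "CARD('n) = 1"
proof (rule ccontr)
  assume "CARD('n) \<noteq> 1"
  then obtain i0 i1 :: 'n where i: "i0 \<noteq> i1"
    by (metis UNIV_eq_I card_1_singleton_iff One_nat_def insertCI singletonD)
  note inf = infinite_UNIV_alg_closed[where 'l = 'l]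
  define R where "R u = (\<Sum>l\<in>UNIV - {i0}. a l * (u $ l) ^ d)" for u :: "'l ^ 'n"
  have split: "diag_form d a u = a i0 * (u $ i0) ^ d + R u" for u
    unfolding diag_form_def R_def by (rule sum.remove) auto
  have polys: "poly_on_lines d (diag_form d a)" "poly_on_lines d R"
    using poly_on_lines_diag_form unfolding diag_form_def R_def by blast+
  have "0 < d" using d(1) by simp
  then have ax: "R (axis i0 1) = 0" "R (axis i1 1) = a i1"
    using i by (simp_all add: R_def axis_power if_distrib cong: if_cong)
  have "diag_form d a (axis i0 1) \<noteq> 0" using ax a by (simp add: split)
  then obtain w1 where "H w1 \<noteq> 0" "diag_form d a w1 \<noteq> 0"
    using poly_on_lines_common_nonzero[OF inf H(1) polys(1) H(2)] by blast
  then have w1: "H w1 * diag_form d a w1 \<noteq> 0" by simp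
  have "R (axis i1 1) \<noteq> 0" using ax a by simp
  then obtain w where w: "H w \<noteq> 0" "diag_form d a w \<noteq> 0" "R w \<noteq> 0"
    using poly_on_lines_common_nonzero[OF inf poly_on_lines_mult[OF H(1) polys(1)] polys(2) w1]
    by auto
  note monomial = similarity_of_diag_form_monomial[OF inf d a T_linear _ T, of _ i0]
  have "H w ^ d * diag_form d a w \<noteq> 0" using w by simp
  then obtain j where j: "T w (axis j 1) $ i0 \<noteq> 0" by (rule monomial)
  let ?L = "\<lambda>t. w + t *s axis i0 1"
  obtain h where h: "\<And>t. H (?L t) = poly h t"
    using H(1) by (rule poly_on_linesE) blast
  obtain g where g: "\<And>t. T (?L t) (axis j 1) $ i0 = poly g t"
  proof -
    obtain e' where "poly_on_lines e' (\<lambda>u. T u (axis j 1) $ i0)" using T_poly by blast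
    then show thesis by (rule poly_on_linesE) (rule that)
  qed
  define f where "f = smult (a i0) ([:w $ i0, 1:] ^ d) + [:R w:]"
  have R_line: "R (?L t) = R w" for t
    by (simp add: R_def axis_def)
  have f: "diag_form d a (?L t) = poly f t" for t
    by (simp only: split R_line) (simp add: f_def axis_def)
  have nz: "h \<noteq> 0" "g \<noteq> 0" "f \<noteq> 0"
    using h[of 0] g[of 0] f[of 0] w j by auto
  \<comment> \<open>The column of the nonzero entry of row \<open>i0\<close> could change along the line. The factors
    \<open>h ^ d * f\<close> and \<open>g\<close> vanish where the similarity factor is zero and where the column differs from \<open>j\<close>.\<close>
  define D where "D = h ^ d * f * g * (smult (a i0) (g ^ d) - smult (a j) (h ^ d * f))"
  have "poly D t = 0" for t
  proof (cases "H (?L t) ^ d * diag_form d a (?L t) = 0")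
    case True
    then show ?thesis by (simp add: D_def h f)
  next
    case False
    then obtain j' where j': "a i0 * (T (?L t) (axis j' 1) $ i0) ^ d =
          (H (?L t) ^ d * diag_form d a (?L t)) * a j'"
        "\<And>l. l \<noteq> j' \<Longrightarrow> T (?L t) (axis l 1) $ i0 = 0"
      by (rule monomial) blast
    show ?thesis
    proof (cases "j = j'")
      case True
      then have "a i0 * poly g t ^ d = poly h t ^ d * poly f t * a j"
        using j'(1) by (simp add: g[symmetric] f[symmetric] h[symmetric])
      then show ?thesis by (simp add: D_def mult_ac)
    next
      case False
      then show ?thesis using j'(2)[of j] by (simp add: D_def g)
    qed
  qed
  then have "D = 0"
    using inf by (intro poly_eq_0_if_many_roots[of _ "Polynomial.degree D" UNIV]) auto
  then have "smult (a j) (h ^ d * f) = smult (a i0) (g ^ d)"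
    using nz by (simp add: D_def)
  then have "smult (inverse (a j)) (smult (a j) (h ^ d * f)) = smult (inverse (a j)) (smult (a i0) (g ^ d))"
    by simp
  then have power: "h ^ d * f = smult (inverse (a j) * a i0) (g ^ d)"
    using a by simp
  obtain z where z: "z ^ d = - R w / a i0"
    using nth_root_exists[of d "- R w / a i0"] \<open>0 < d\<close> by blast
  have "poly f (z - w $ i0) = 0"
    using a by (simp add: f_def z)
  then have "poly (pderiv f) (z - w $ i0) = 0"
    using d(1) a nz power
    by (intro dth_power_multiple_has_no_simple_root[of d "inverse (a j) * a i0" g h]) auto
  then have "a i0 * (of_nat d * z ^ (d - 1)) = 0"
    by (simp add: f_def pderiv_add pderiv_smult pderiv_power pderiv_pCons)
  then have "z = 0" using a d by auto
  then show False using z w(3) a \<open>0 < d\<close> by (simp add: power_0_left)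
qed

section \<open>Polarization and extension of scalars\<close>

lemma of_nat_inj_on_small:
  assumes "CHAR('k::field) = 0 \<or> CHAR('k) > d"
  shows "inj_on (of_nat :: nat \<Rightarrow> 'k) {..d}"
proof (rule inj_onI)
  fix i j assume "i \<in> {..d}" "j \<in> {..d}" "of_nat i = (of_nat j :: 'k)"
  then have "[i = j] (mod CHAR('k))" by (simp add: of_nat_eq_iff_cong_CHAR)
  then show "i = j"
    using assms \<open>i \<in> _\<close> \<open>j \<in> _\<close> by (auto simp: cong_def)
qed

lemma card_of_nat_small:
  assumes "CHAR('k::field) = 0 \<or> CHAR('k) > d"
  shows "d < card ((of_nat :: nat \<Rightarrow> 'k) ` {..d})"
  using card_image[OF of_nat_inj_on_small[OF assms]] by simp

lemma of_nat_small_nonzero: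
  assumes "CHAR('k::field) = 0 \<or> CHAR('k) > d" "0 < m" "m \<le> d"
  shows "of_nat m \<noteq> (0 :: 'k)"
  using inj_onD[OF of_nat_inj_on_small[OF assms(1)], of m 0] assms(2,3) by auto

lemma poly_eq_0_if_vanishes_everywhere:
  fixes q :: "'k::field poly"
  assumes "CHAR('k) = 0 \<or> CHAR('k) > d" "Polynomial.degree q \<le> d" "\<And>t. poly q t = 0"
  shows "q = 0"
  using poly_eq_0_if_many_roots[OF assms(2)] card_of_nat_small[OF assms(1)] assms(3) by blast

lemma homogeneous_exponent_le:
  assumes "homogeneous d p" "m \<in> Poly_Mapping.keys p"
  shows "Poly_Mapping.lookup m i \<le> d"
  using assms member_le_sum[of i UNIV "Poly_Mapping.lookup m"] by (auto simp: homogeneous_def)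

lemma mpoly_eval_inj:
  fixes p q :: "('n::finite, 'k::field) mpoly"
  assumes char: "CHAR('k) = 0 \<or> CHAR('k) > d"
    and hom: "homogeneous d p" "homogeneous d q" and eq: "mpoly_eval p = mpoly_eval q"
  shows "p = q"
proof (rule ccontr)
  assume "p \<noteq> q"
  then have nz: "p - q \<noteq> 0" by simp
  interpret unital_ring_hom "\<lambda>c::'k. c" by unfold_locales auto
  have "Poly_Mapping.keys (p - q) \<subseteq> Poly_Mapping.keys p \<union> Poly_Mapping.keys q"
    by (auto simp: in_keys_iff lookup_minus)
  then have bound: "Poly_Mapping.lookup m i \<le> d" if "m \<in> Poly_Mapping.keys (p - q)" for m i
    using homogeneous_exponent_le[OF hom(1)] homogeneous_exponent_le[OF hom(2)] that by blast
  obtain x :: "'k ^ 'n" where "peval (\<lambda>c. c) (\<lambda>i. x $ i) (p - q) \<noteq> 0"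
    by (rule peval_nonzero[OF nz, of "\<lambda>c. c" UNIV d])
      (use bound card_of_nat_small[OF char] in \<open>auto intro: less_le_trans card_mono\<close>)
  moreover have "peval (\<lambda>c. c) (\<lambda>i. x $ i) p = peval (\<lambda>c. c) (\<lambda>i. x $ i) (p - q) + peval (\<lambda>c. c) (\<lambda>i. x $ i) q"
    using peval_add[of _ "p - q" q] by simp
  ultimately show False using eq by (simp add: fun_eq_iff mpoly_eval_peval)
qed

text \<open>
  The hypothesis on the characteristic makes \<open>0, \<dots>, d\<close> distinct in the field, which suffices to
  separate homogeneous polynomials of degree \<open>d\<close>; so the definite description is well-defined.
\<close>

lemma form_poly:
  fixes \<phi> :: "'v::ab_group_add \<Rightarrow> 'k::field"
  assumes "CHAR('k) = 0 \<or> CHAR('k) > d" "is_form sc b d \<phi>"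
  shows "homogeneous d (form_poly sc b d \<phi>)" "in_coords sc b \<phi> = mpoly_eval (form_poly sc b d \<phi>)"
proof -
  obtain p where "homogeneous d p \<and> in_coords sc b \<phi> = mpoly_eval p"
    using assms(2) by (auto simp: is_form_def)
  then have "homogeneous d (form_poly sc b d \<phi>) \<and> in_coords sc b \<phi> = mpoly_eval (form_poly sc b d \<phi>)"
    unfolding form_poly_def by (rule theI) (use mpoly_eval_inj[OF assms(1)] \<open>homogeneous d p \<and> _\<close> in metis)
  then show "homogeneous d (form_poly sc b d \<phi>)" "in_coords sc b \<phi> = mpoly_eval (form_poly sc b d \<phi>)"
    by auto
qed

definition partial_deriv :: "('k::comm_ring_1 \<Rightarrow> 'r::comm_ring_1) \<Rightarrow> ('n::finite \<Rightarrow> 'r) \<Rightarrow>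
    (('n \<Rightarrow>\<^sub>0 nat) \<Rightarrow>\<^sub>0 'k) \<Rightarrow> 'n \<Rightarrow> 'r" where
  "partial_deriv h x p i = (\<Sum>m\<in>Poly_Mapping.keys p. h (Poly_Mapping.lookup p m) *
     (of_nat (Poly_Mapping.lookup m i) * x i ^ (Poly_Mapping.lookup m i - 1) *
      (\<Prod>j\<in>UNIV - {i}. x j ^ Poly_Mapping.lookup m j)))"

lemma (in unital_ring_hom) hom_partial_deriv:
  "h (partial_deriv g x p i) = partial_deriv (\<lambda>c. h (g c)) (\<lambda>i. h (x i)) p i"
  by (simp add: partial_deriv_def sum mult prod power of_nat)

lemma peval_on_line:
  fixes x v :: "'n::finite \<Rightarrow> 'l::field"
  assumes "homogeneous d p"
  obtains q where "Polynomial.degree q \<le> d" "\<And>t. peval h (\<lambda>i. x i + t * v i) p = poly q t"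
    "Polynomial.coeff q 1 = (\<Sum>i\<in>UNIV. v i * partial_deriv h x p i)"
proof
  let ?l = Poly_Mapping.lookup
  define q where "q = (\<Sum>m\<in>Poly_Mapping.keys p. smult (h (?l p m)) (\<Prod>i\<in>UNIV. [:x i, v i:] ^ ?l m i))"
  show "Polynomial.degree q \<le> d"
    unfolding q_def
  proof (rule degree_sum_le)
    fix m assume m: "m \<in> Poly_Mapping.keys p"
    have "Polynomial.degree (\<Prod>i\<in>UNIV. [:x i, v i:] ^ ?l m i) \<le>
        (\<Sum>i\<in>UNIV. Polynomial.degree ([:x i, v i:] ^ ?l m i))"
      using degree_prod_sum_le[of UNIV "\<lambda>i. [:x i, v i:] ^ ?l m i"] by (simp add: o_def)
    also have "\<dots> \<le> (\<Sum>i\<in>UNIV. 1 * ?l m i)"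
      by (intro sum_mono order_trans[OF degree_power_le] mult_right_mono) auto
    also have "\<dots> = d" using assms m by (simp add: homogeneous_def)
    finally show "Polynomial.degree (smult (h (?l p m)) (\<Prod>i\<in>UNIV. [:x i, v i:] ^ ?l m i)) \<le> d"
      by (rule order_trans[OF degree_smult_le])
  qed simp
  show "peval h (\<lambda>i. x i + t * v i) p = poly q t" for t
    by (simp add: q_def peval_def poly_sum poly_prod)
  have "Polynomial.coeff q 1 = poly (pderiv q) 0"
    by (simp add: poly_0_coeff_0 coeff_pderiv)
  also have "\<dots> = (\<Sum>m\<in>Poly_Mapping.keys p. h (?l p m) * (\<Sum>i\<in>UNIV.
      (\<Prod>j\<in>UNIV - {i}. x j ^ ?l m j) * (of_nat (?l m i) * (x i ^ (?l m i - 1) * v i))))"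
    by (simp add: q_def pderiv_sum pderiv_smult pderiv_prod pderiv_power pderiv_pCons poly_sum poly_prod mult_ac)
  also have "\<dots> = (\<Sum>m\<in>Poly_Mapping.keys p. \<Sum>i\<in>UNIV. v i * (h (?l p m) *
      (of_nat (?l m i) * x i ^ (?l m i - 1) * (\<Prod>j\<in>UNIV - {i}. x j ^ ?l m j))))"
    by (simp add: sum_distrib_left mult_ac)
  also have "\<dots> = (\<Sum>i\<in>UNIV. v i * partial_deriv h x p i)"
    unfolding partial_deriv_def sum_distrib_left by (rule sum.swap)
  finally show "Polynomial.coeff q 1 = (\<Sum>i\<in>UNIV. v i * partial_deriv h x p i)" .
qed

text \<open>
  Only the two lowest coefficients of the binomial expansion of \<open>\<theta> (us, x + t y, \<dots>, x + t y)\<close> are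
  recorded: polarization and the comparison with partial derivatives use the coefficient of \<open>t\<close>, and
  the induction on \<open>j\<close> obtains it from both.
\<close>

lemma multilinear_on_line:
  fixes \<theta> :: "'v::ab_group_add list \<Rightarrow> 'k::field"
  assumes "symmetric_multilinear sc d \<theta>" "length us + j = d"
  shows "\<exists>q. Polynomial.degree q \<le> j \<and> (\<forall>t. \<theta> (us @ replicate j (x + sc t y)) = poly q t) \<and>
    Polynomial.coeff q 0 = \<theta> (us @ replicate j x) \<and>
    Polynomial.coeff q 1 = of_nat j * \<theta> (us @ y # replicate (j - 1) x)"
  using assms(2)
proof (induction j arbitrary: us)
  case 0
  show ?case by (intro exI[of _ "[:\<theta> us:]"]) simp
next
  case (Suc j)
  have sym: "\<theta> vs = \<theta> ws" if "length vs = d" "mset vs = mset ws" for vs ws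
    using assms(1) that unfolding symmetric_multilinear_def by blast
  obtain p where p: "Polynomial.degree p \<le> j"
      "\<And>t. \<theta> ((us @ [x]) @ replicate j (x + sc t y)) = poly p t"
      "Polynomial.coeff p 0 = \<theta> ((us @ [x]) @ replicate j x)"
      "Polynomial.coeff p 1 = of_nat j * \<theta> ((us @ [x]) @ y # replicate (j - 1) x)"
    using Suc.IH[of "us @ [x]"] Suc.prems by auto
  obtain q where q: "Polynomial.degree q \<le> j"
      "\<And>t. \<theta> ((us @ [y]) @ replicate j (x + sc t y)) = poly q t"
      "Polynomial.coeff q 0 = \<theta> ((us @ [y]) @ replicate j x)"
    using Suc.IH[of "us @ [y]"] Suc.prems by auto
  have "\<theta> (us @ replicate (Suc j) (x + sc t y)) = poly (p + pCons 0 q) t" for t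
  proof -
    let ?z = "x + sc t y"
    have lin: "Vector_Spaces.linear sc (*) (\<lambda>v. \<theta> (us @ v # replicate j ?z))"
      using assms(1) Suc.prems unfolding symmetric_multilinear_def by auto
    interpret lin: Vector_Spaces.linear sc "(*)" "\<lambda>v. \<theta> (us @ v # replicate j ?z)" by (rule lin)
    have "\<theta> (us @ replicate (Suc j) ?z) = \<theta> (us @ x # replicate j ?z) + t * \<theta> (us @ y # replicate j ?z)"
      using lin.add lin.scale by simp
    then show ?thesis using p(2)[of t] q(2)[of t] by simp
  qed
  moreover have "Polynomial.coeff (p + pCons 0 q) 1 =
      of_nat (Suc j) * \<theta> (us @ y # replicate (Suc j - 1) x)"
  proof (cases j)
    case 0
    then show ?thesis using p(4) q(3) by simp
  next
    case (Suc i)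
    note j = this
    have "\<theta> ((us @ [x]) @ y # replicate (j - 1) x) = \<theta> (us @ y # replicate j x)"
      using Suc.prems unfolding j by (intro sym) simp_all
    then show ?thesis using p(4) q(3) by (simp add: algebra_simps)
  qed
  moreover have "Polynomial.degree (p + pCons 0 q) \<le> Suc j"
    using p(1) q(1) by (intro degree_add_le) (auto intro: order_trans[OF degree_pCons_le])
  ultimately show ?case using p(3) by (intro exI[of _ "p + pCons 0 q"]) auto
qed

text \<open>
  The coefficient of \<open>t\<close> in \<open>\<theta> (us, x + t y, \<dots>, x + t y)\<close> is an integer between \<open>1\<close> and \<open>d\<close> times
  \<open>\<theta> (us, y, x, \<dots>, x)\<close>, so the diagonal arguments can be replaced by arbitrary ones one by one.
\<close>

lemma polarization:
  fixes \<theta> :: "'v::ab_group_add list \<Rightarrow> 'k::field"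
  assumes sm: "symmetric_multilinear sc d \<theta>" and char: "CHAR('k) = 0 \<or> CHAR('k) > d"
    and "length us + j = d" "\<And>x. \<theta> (us @ replicate j x) = 0" "length ws = j"
  shows "\<theta> (us @ ws) = 0"
  using assms(3-5)
proof (induction j arbitrary: us ws)
  case 0
  then show ?case by simp
next
  case (Suc j)
  obtain y ws' where ws: "ws = y # ws'" "length ws' = j"
    using Suc.prems(3) by (metis length_Suc_conv)
  have "\<theta> ((us @ [y]) @ replicate j x) = 0" for x
  proof -
    obtain q where q: "Polynomial.degree q \<le> Suc j"
        "\<And>t. \<theta> (us @ replicate (Suc j) (x + sc t y)) = poly q t"
        "Polynomial.coeff q 1 = of_nat (Suc j) * \<theta> (us @ y # replicate (Suc j - 1) x)"
      using multilinear_on_line[OF sm Suc.prems(1)] by blast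
    have "poly q t = 0" for t using q(2) Suc.prems(2) by metis
    then have "q = 0"
      using q(1) Suc.prems(1) by (intro poly_eq_0_if_vanishes_everywhere[OF char]) auto
    moreover have "of_nat (Suc j) \<noteq> (0 :: 'k)"
      using Suc.prems(1) by (intro of_nat_small_nonzero[OF char]) auto
    ultimately show ?thesis using q(3) by simp
  qed
  then have "\<theta> ((us @ [y]) @ ws') = 0"
    using Suc.prems(1) ws(2) by (intro Suc.IH[of "us @ [y]" ws']) simp_all
  then show ?case by (simp add: ws)
qed

text \<open>
  The derivative of \<open>\<phi>\<close> at \<open>z\<close> in the direction \<open>W\<close> is \<open>d \<theta> (W, z, \<dots>, z)\<close>. If it vanishes for
  all \<open>z\<close>, polarization puts \<open>W\<close> in the radical of \<open>\<theta>\<close>.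
\<close>

lemma nondegenerate_derivatives_independent:
  fixes b :: "'n::finite \<Rightarrow> 'v::ab_group_add" and p :: "('n, 'k::field) mpoly"
  assumes char: "CHAR('k) = 0 \<or> CHAR('k) > d" and d: "d > 0"
    and p: "homogeneous d p" "in_coords sc b \<phi> = mpoly_eval p"
    and vs: "vector_space sc" and nondeg: "nondegenerate sc d \<phi>"
    and w: "\<And>x. (\<Sum>i\<in>UNIV. w i * partial_deriv (\<lambda>c. c) x p i) = 0"
    and span: "module.span sc (range b) = UNIV" and inj: "inj b"
  shows "(\<Sum>i\<in>UNIV. sc (w i) (b i)) = 0"
proof -
  interpret vector_space sc by (rule vs)
  obtain \<theta> where \<theta>: "symmetric_multilinear sc d \<theta>" "\<And>v. \<phi> v = \<theta> (replicate d v)"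
    "\<And>v. (\<And>ws. length ws = d - 1 \<Longrightarrow> \<theta> (v # ws) = 0) \<Longrightarrow> v = 0"
    using nondeg unfolding nondegenerate_def by metis
  define W where "W = (\<Sum>i\<in>UNIV. sc (w i) (b i))"
  have diag: "\<theta> ([W] @ replicate (d - 1) z) = 0" for z
  proof -
    have "z \<in> span (range b)" using span by simp
    then obtain c where "z = (\<Sum>v\<in>range b. sc (c v) v)"
      by (auto simp: span_finite)
    then have z: "z = (\<Sum>i\<in>UNIV. sc (c (b i)) (b i))"
      using inj by (simp add: sum.reindex)
    obtain q where q: "Polynomial.degree q \<le> d"
        "\<And>t. \<theta> ([] @ replicate d (z + sc t W)) = poly q t"
        "Polynomial.coeff q 1 = of_nat d * \<theta> ([] @ W # replicate (d - 1) z)"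
      using multilinear_on_line[OF \<theta>(1), of "[]" d z W] by auto
    obtain r where r: "Polynomial.degree r \<le> d"
        "\<And>t. peval (\<lambda>c. c) (\<lambda>i. c (b i) + t * w i) p = poly r t"
        "Polynomial.coeff r 1 = (\<Sum>i\<in>UNIV. w i * partial_deriv (\<lambda>c. c) (\<lambda>i. c (b i)) p i)"
      by (rule peval_on_line[OF p(1), where h = "\<lambda>c. c" and x = "\<lambda>i. c (b i)" and v = w]) blast
    have "poly q t = poly r t" for t
    proof -
      have "poly r t = in_coords sc b \<phi> (\<chi> i. c (b i) + t * w i)"
        by (simp add: p(2) mpoly_eval_peval r(2)[symmetric])
      also have "\<dots> = \<phi> (z + sc t W)"
        by (simp add: in_coords_def z W_def scale_left_distrib sum.distrib scale_sum_right)
      finally show ?thesis using q(2)[of t] \<theta>(2) by simp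
    qed
    then have "q - r = 0"
      using q(1) r(1) by (intro poly_eq_0_if_vanishes_everywhere[OF char] degree_diff_le) auto
    then have "of_nat d * \<theta> ([W] @ replicate (d - 1) z) = 0"
      using q(3) r(3) w by simp
    then show ?thesis using of_nat_small_nonzero[OF char d] by simp
  qed
  have "\<theta> ([W] @ ws) = 0" if "length ws = d - 1" for ws
    by (rule polarization[OF \<theta>(1) char, of "[W]" "d - 1"]) (use d that diag in simp_all)
  then show ?thesis using \<theta>(3)[of W] by (simp add: W_def)
qed

text \<open>
  Nondegeneracy survives the passage to \<open>'l\<close>. If \<open>\<phi>\<close> is invariant under translation by all
  multiples of \<open>v\<close>, then \<open>v\<close> solves the linear system \<open>\<Sum>\<^sub>i v\<^sub>i \<partial>\<^sub>i p (x) = 0\<close>, \<open>x\<close> over \<open>'k\<close>,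
  whose coefficients lie in \<open>'k\<close>. Applying a \<open>'k\<close>-linear functional \<open>'l \<Rightarrow> 'k\<close> that does not vanish on \<open>v i0\<close> to the coordinates of
  \<open>v\<close> turns it into a nonzero solution over \<open>'k\<close>, contrary to nondegeneracy over \<open>'k\<close>.
\<close>

lemma nondegenerate_after_extension:
  fixes b :: "'n::finite \<Rightarrow> 'v::ab_group_add" and p :: "('n, 'k::field) mpoly"
    and \<iota> :: "'k \<Rightarrow> 'l::field" and v :: "'n \<Rightarrow> 'l"
  assumes char: "CHAR('k) = 0 \<or> CHAR('k) > d" and charl: "CHAR('l) = 0 \<or> CHAR('l) > d" and d: "d > 0"
    and fd: "finite_dimensional_vector_space sc (range b)" "inj b"
    and p: "homogeneous d p" "in_coords sc b \<phi> = mpoly_eval p"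
    and nondeg: "nondegenerate sc d \<phi>"
    and \<iota>: "unital_ring_hom \<iota>"
    and v: "\<And>x t. peval \<iota> (\<lambda>i. x i + t * v i) p = peval \<iota> x p"
  shows "v i0 = 0"
proof (rule ccontr)
  assume v0: "v i0 \<noteq> 0"
  interpret fd: finite_dimensional_vector_space sc "range b" by (rule fd)
  interpret ext: unital_ring_hom \<iota> by (rule \<iota>)
  have deriv: "(\<Sum>i\<in>UNIV. v i * \<iota> (partial_deriv (\<lambda>c. c) x p i)) = 0" for x
  proof -
    obtain q where q: "Polynomial.degree q \<le> d"
        "\<And>t. peval \<iota> (\<lambda>i. \<iota> (x i) + t * v i) p = poly q t"
        "Polynomial.coeff q 1 = (\<Sum>i\<in>UNIV. v i * partial_deriv \<iota> (\<lambda>i. \<iota> (x i)) p i)"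
      by (rule peval_on_line[OF p(1), where h = \<iota> and x = "\<lambda>i. \<iota> (x i)" and v = v]) blast
    have "q - [:peval \<iota> (\<lambda>i. \<iota> (x i)) p:] = 0"
      using q(1) by (intro poly_eq_0_if_vanishes_everywhere[OF charl] degree_diff_le)
        (simp_all add: q(2)[symmetric] v)
    then have "q = [:peval \<iota> (\<lambda>i. \<iota> (x i)) p:]" by simp
    then have "Polynomial.coeff q 1 = 0" by simp
    then show ?thesis using q(3) by (simp add: ext.hom_partial_deriv)
  qed
  interpret L: vector_space "\<lambda>c l. \<iota> c * l"
    by unfold_locales (simp_all add: ext.add ext.mult ext.one algebra_simps)
  interpret LK: vector_space_pair "\<lambda>c l. \<iota> c * l" "(*) :: 'k \<Rightarrow> _" ..
  have "L.independent {v i0}" using v0 by simp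
  then obtain f where lin: "Vector_Spaces.linear (\<lambda>c l. \<iota> c * l) (*) f" and one: "f (v i0) = 1"
    using LK.linear_independent_extend[of "{v i0}" "\<lambda>_. 1"] by auto
  interpret lin: Vector_Spaces.linear "\<lambda>c l. \<iota> c * l" "(*)" f by (rule lin)
  define w where "w i = f (v i)" for i
  have "(\<Sum>i\<in>UNIV. w i * partial_deriv (\<lambda>c. c) x p i) = 0" for x
  proof -
    have "f (\<Sum>i\<in>UNIV. \<iota> (partial_deriv (\<lambda>c. c) x p i) * v i) =
        (\<Sum>i\<in>UNIV. partial_deriv (\<lambda>c. c) x p i * w i)"
      unfolding w_def lin.sum lin.scale ..
    then show ?thesis using deriv[of x] lin.zero by (simp add: mult.commute)
  qed
  then have "(\<Sum>i\<in>UNIV. sc (w i) (b i)) = 0"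
    using fd.span_Basis
    by (intro nondegenerate_derivatives_independent[OF char d p fd.vector_space_axioms nondeg _ _ fd(2)]) auto
  then have "(\<Sum>u\<in>range b. sc (w (inv_into UNIV b u)) u) = 0"
    using fd(2) by (simp add: sum.reindex)
  then have "w (inv_into UNIV b (b i0)) = 0"
    by (intro fd.independentD[OF fd.independent_Basis]) auto
  then show False using one fd(2) by (simp add: w_def)
qed

section \<open>Strong multiplicativity as a polynomial identity\<close>

abbreviation const_poly :: "'k::comm_ring_1 \<Rightarrow> ('n \<Rightarrow>\<^sub>0 nat) \<Rightarrow>\<^sub>0 'k" where
  "const_poly \<equiv> Poly_Mapping.single 0"

abbreviation var_poly :: "'n \<Rightarrow> ('n \<Rightarrow>\<^sub>0 nat) \<Rightarrow>\<^sub>0 'k::comm_ring_1" where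
  "var_poly i \<equiv> Poly_Mapping.single (Poly_Mapping.single i 1) 1"

lemma unital_ring_hom_const_poly: "unital_ring_hom (const_poly :: 'k::comm_ring_1 \<Rightarrow> ('n \<Rightarrow>\<^sub>0 nat) \<Rightarrow>\<^sub>0 'k)"
  by unfold_locales (simp_all add: single_add mult_single)

lemma unital_ring_hom_Fract: "unital_ring_hom (\<lambda>r::'a::idom. Fract r 1)"
  by unfold_locales (simp_all add: One_fract_def)

lemma (in unital_ring_hom) peval_const_poly: "peval h x (const_poly c) = h c"
  by (simp add: peval_single)

lemma (in unital_ring_hom) peval_var_poly: "peval h x (var_poly i) = x i"
proof -
  have "(\<Prod>j\<in>UNIV. x j ^ Poly_Mapping.lookup (Poly_Mapping.single i (1::nat)) j) =
      (\<Prod>j\<in>UNIV. if j = i then x j else 1)"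
    by (intro prod.cong) (auto simp: lookup_single when_def)
  then show ?thesis by (simp add: peval_single one)
qed

lemma common_denominator:
  fixes z :: "'i \<Rightarrow> 'a::idom fract"
  assumes "finite I"
  shows "\<exists>c N. c \<noteq> 0 \<and> (\<forall>i\<in>I. Fract c 1 * z i = Fract (N i) 1)"
  using assms
proof (induction I)
  case empty
  show ?case by (intro exI[of _ 1]) simp
next
  case (insert i I)
  then obtain c N where c: "c \<noteq> 0" "\<And>j. j \<in> I \<Longrightarrow> Fract c 1 * z j = Fract (N j) 1" by blast
  obtain n m where z: "z i = Fract n m" "m \<noteq> 0" by (cases "z i") auto
  define N' where "N' j = (if j = i then c * n else m * N j)" for j
  have "Fract (c * m) 1 * z j = Fract (N' j) 1" if "j \<in> insert i I" for j
  proof (cases "j = i")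
    case True
    then show ?thesis using z by (simp add: N'_def eq_fract)
  next
    case False
    then have "Fract m 1 * (Fract c 1 * z j) = Fract m 1 * Fract (N j) 1"
      using c that by simp
    then show ?thesis using False by (simp add: N'_def mult_ac flip: mult.assoc)
  qed
  then show ?case using c(1) z(2) by (intro exI[of _ "c * m"] exI[of _ N']) simp
qed

text \<open>
  The matrix of the isomorphism \<open>\<phi>(X) \<phi>\<^sub>K \<cong> \<phi>\<^sub>K\<close> is \<open>N / c\<close> with a common denominator \<open>c\<close>. As
  \<open>\<phi>\<^sub>K\<close> is homogeneous, multiplying by \<open>c ^ d\<close> gives \<open>\<phi>(N y) = c\<^sup>d \<phi>(X) \<phi>(y)\<close>, an identity between
  polynomials, which, unlike the isomorphism over \<open>K\<close>, can be specialized at every point.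
\<close>

lemma strongly_multiplicative_identity:
  fixes \<phi> :: "'v::ab_group_add \<Rightarrow> 'k::field" and b :: "'n::{finite,linorder} \<Rightarrow> 'v"
  assumes "strongly_multiplicative sc b d \<phi>" and hom: "homogeneous d (form_poly sc b d \<phi>)"
  defines "p \<equiv> form_poly sc b d \<phi>"
  obtains c :: "('n, 'k) mpoly" and N :: "'n \<Rightarrow> 'n \<Rightarrow> ('n, 'k) mpoly"
  where "c \<noteq> 0"
    "\<And>y. peval const_poly (\<lambda>i. \<Sum>l\<in>UNIV. const_poly (y l) * N i l) p =
      c ^ d * peval const_poly var_poly p * const_poly (peval (\<lambda>a. a) y p)"
proof -
  define j :: "('n, 'k) mpoly \<Rightarrow> ('n, 'k) ratfun" where "j r = Fract r 1" for r
  interpret C: unital_ring_hom "const_poly :: 'k \<Rightarrow> ('n, 'k) mpoly" by (rule unital_ring_hom_const_poly)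
  interpret j: unital_ring_hom j unfolding j_def by (rule unital_ring_hom_Fract)
  have j_inj: "j r = j s \<longleftrightarrow> r = s" for r s by (simp add: j_def eq_fract)
  have rc: "ratfun_const a = j (const_poly a)" for a by (simp add: ratfun_const_def j_def)
  have rc0: "(ratfun_const a :: ('n, 'k) ratfun) = 0 \<longleftrightarrow> a = 0" for a
    using j_inj[of "const_poly a" 0] by (simp add: rc j.zero) (metis lookup_single_eq lookup_zero single_zero)
  have gen: "generic_vector $ i = j (var_poly i)" for i by (simp add: generic_vector_def j_def)
  define \<Phi> where "\<Phi> z = peval (\<lambda>a. j (const_poly a)) z p" for z
  have \<Phi>: "base_change ratfun_const sc b d \<phi> z = \<Phi> (\<lambda>i. z $ i)" for z
    unfolding base_change_def mpoly_eval_map[OF rc0] by (simp only: \<Phi>_def p_def rc[abs_def])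
  obtain f :: "(('n, 'k) ratfun, 'n) vec \<Rightarrow> (('n, 'k) ratfun, 'n) vec"
    where lin: "Vector_Spaces.linear (*s) (*s) f"
      and f: "\<And>z. \<Phi> (\<lambda>i. f z $ i) = \<Phi> (\<lambda>i. generic_vector $ i) * \<Phi> (\<lambda>i. z $ i)"
    using assms(1) unfolding strongly_multiplicative_def isomorphic_forms_def Let_def \<Phi> by blast
  obtain c N where c: "c \<noteq> 0" and N: "\<And>i l. j c * (f (axis l 1) $ i) = j (N (i, l))"
    using common_denominator[of UNIV "\<lambda>(i, l). f (axis l 1) $ i"] by (auto simp: j_def)
  have "peval const_poly (\<lambda>i. \<Sum>l\<in>UNIV. const_poly (y l) * N (i, l)) p =
      c ^ d * peval const_poly var_poly p * const_poly (peval (\<lambda>a. a) y p)" for y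
  proof -
    define z :: "(('n, 'k) ratfun, 'n) vec" where "z = (\<chi> l. j (const_poly (y l)))"
    have scaled: "j c * (f z $ i) = j (\<Sum>l\<in>UNIV. const_poly (y l) * N (i, l))" for i
      by (subst linear_component[OF lin])
        (simp add: sum_distrib_left z_def j.sum j.mult N[symmetric] mult_ac)
    have "\<Phi> (\<lambda>i. j (\<Sum>l\<in>UNIV. const_poly (y l) * N (i, l))) = j c ^ d * \<Phi> (\<lambda>i. f z $ i)"
      unfolding \<Phi>_def p_def scaled[symmetric] by (rule peval_scale[OF hom])
    also have "\<dots> = j c ^ d * (\<Phi> (\<lambda>i. j (var_poly i)) * \<Phi> (\<lambda>l. j (const_poly (y l))))"
      by (simp only: f gen) (simp add: z_def)
    finally have "j (peval const_poly (\<lambda>i. \<Sum>l\<in>UNIV. const_poly (y l) * N (i, l)) p) =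
        j (c ^ d * peval const_poly var_poly p * const_poly (peval (\<lambda>a. a) y p))"
      by (simp only: \<Phi>_def j.hom_peval j.mult j.power C.hom_peval mult.assoc)
    then show ?thesis by (simp only: j_inj)
  qed
  then show ?thesis using c by (intro that[of c "\<lambda>i l. N (i, l)"])
qed

text \<open>
  Substitution is a ring homomorphism, so the identity passes to points \<open>x\<close>, \<open>y\<close> over any commutative
  ring that receives the coefficients, with \<open>y\<close> still defined over the base ring.
\<close>

lemma (in unital_ring_hom) evaluate_identity:
  assumes id: "\<And>y. peval const_poly (\<lambda>i. \<Sum>l\<in>UNIV. const_poly (y l) * N i l) p =
      c ^ d * peval const_poly var_poly p * const_poly (peval (\<lambda>a. a) y p)"
  shows "peval h (\<lambda>i. \<Sum>l\<in>UNIV. h (y l) * peval h x (N i l)) p =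
      peval h x c ^ d * peval h x p * peval h (\<lambda>l. h (y l)) p"
proof -
  interpret E: unital_ring_hom "peval h x" by (rule unital_ring_hom_peval)
  show ?thesis
    using arg_cong[OF id[of y], of "peval h x"]
    by (simp add: E.hom_peval E.mult E.power E.sum peval_const_poly peval_var_poly[unfolded One_nat_def] hom_peval)
qed

section \<open>A separable strongly multiplicative form is one-dimensional\<close>

text \<open>
  The polynomial identity, specialized at points over the algebraic closure and transported by \<open>g\<close> to
  the coordinates in which \<open>\<phi>\<close> is diagonal, is the hypothesis of the core lemma. Nondegeneracy over
  the closure makes \<open>g\<close> invertible and all \<open>a i\<close> nonzero: a vector in the kernel of \<open>g\<close>, or on an
  axis with \<open>a i = 0\<close>, would be a period of \<open>\<phi>\<close>.
\<close>

lemma diagonal_over_closure_dim_1: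
  fixes sc :: "'k::field \<Rightarrow> 'v::ab_group_add \<Rightarrow> 'v"
    and b :: "'n::{finite,linorder} \<Rightarrow> 'v"
    and g :: "('k alg_closure, 'n) vec \<Rightarrow> ('k alg_closure, 'n) vec"
  assumes d: "d \<ge> 3" and char: "CHAR('k) = 0 \<or> CHAR('k) > d"
    and fd: "finite_dimensional_vector_space sc (range b)" "inj b"
    and form: "is_form sc b d \<phi>" and nondeg: "nondegenerate sc d \<phi>"
    and mult: "strongly_multiplicative sc b d \<phi>"
    and g: "Vector_Spaces.linear (*s) (*s) g"
    and diag: "\<And>x. peval to_ac (\<lambda>i. x $ i) (form_poly sc b d \<phi>) = diag_form d a (g x)"
  shows "CARD('n) = 1"
proof -
  define p where "p = form_poly sc b d \<phi>"
  have p: "homogeneous d p" "in_coords sc b \<phi> = mpoly_eval p"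
    unfolding p_def by (rule form_poly[OF char form])+
  have charl: "CHAR('k alg_closure) = 0 \<or> CHAR('k alg_closure) > d" using char by simp
  interpret ac: unital_ring_hom "to_ac :: 'k \<Rightarrow> _" by unfold_locales simp_all
  have d0: "0 < d" using d by simp
  have nondegl: "v = 0" if v: "\<And>x t. diag_form d a (g x + t *s g v) = diag_form d a (g x)" for v
  proof -
    have "peval to_ac (\<lambda>i. x i + t * v $ i) p = peval to_ac x p" for x t
      using v[of "vec_lambda x" t] diag[of "vec_lambda x"] diag[of "vec_lambda x + t *s v"]
      by (simp add: p_def vec.linear_add[OF g] vec.linear_scale[OF g])
    then have "v $ i = 0" for i
      by (intro nondegenerate_after_extension[OF char charl d0 fd p nondeg ac.unital_ring_hom_axioms])
    then show ?thesis by (simp add: vec_eq_iff)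
  qed
  have inj: "inj g"
    unfolding vec.linear_inj_iff_eq_0[OF g] by (auto intro: nondegl)
  then have "surj g" by (rule vec.linear_inj_imp_surj[OF g])
  then obtain g' where g': "Vector_Spaces.linear (*s) (*s) g'" and "g \<circ> g' = id"
    using vec.linear_surjective_right_inverse[OF g] by blast
  then have gg': "g (g' x) = x" for x by (simp add: fun_eq_iff)
  then have g'g: "g' (g x) = x" for x using inj by (metis injD)
  have a: "a i \<noteq> 0" for i
  proof
    assume "a i = 0"
    then have "diag_form d a (u + t *s axis i 1) = diag_form d a u" for u t
      unfolding diag_form_def by (intro sum.cong) (auto simp: axis_def)
    then have "g' (axis i 1) = 0" by (intro nondegl) (simp add: gg')
    then show False using gg'[of "axis i 1"] vec.linear_0[OF g] by (simp add: axis_eq_0_iff)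
  qed
  obtain c :: "('n, 'k) mpoly" and N where c: "c \<noteq> 0"
    and id: "\<And>y. peval const_poly (\<lambda>i. \<Sum>l\<in>UNIV. const_poly (y l) * N i l) p =
      c ^ d * peval const_poly var_poly p * const_poly (peval (\<lambda>a. a) y p)"
    using strongly_multiplicative_identity[OF mult] p(1) unfolding p_def by blast
  define T0 where "T0 x y = (\<chi> i. \<Sum>l\<in>UNIV. y $ l * peval to_ac (\<lambda>i. x $ i) (N i l))"
    for x y :: "('k alg_closure, 'n) vec"
  have T0_linear: "Vector_Spaces.linear (*s) (*s) (T0 x)" for x
    by unfold_locales (simp_all add: T0_def vec_eq_iff algebra_simps sum.distrib sum_distrib_left)
  define \<Phi> where "\<Phi> x = peval to_ac (\<lambda>i. x $ i) p" for x :: "('k alg_closure, 'n) vec"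
  have \<Phi>_diag: "\<Phi> x = diag_form d a (g x)" for x using diag by (simp add: \<Phi>_def p_def)
  have \<Phi>_poly: "poly_on_lines d \<Phi>"
    unfolding \<Phi>_def by (rule poly_on_lines_peval) (use p(1) in \<open>simp add: homogeneous_def\<close>)
  \<comment> \<open>The identity holds for vectors \<open>y\<close> over \<open>'k\<close>; both sides have degree \<open>d\<close> in \<open>y\<close>, so it
    extends to vectors over the closure.\<close>
  have mult0: "\<Phi> (T0 x y) = peval to_ac (\<lambda>i. x $ i) c ^ d * \<Phi> x * \<Phi> y" for x y
  proof -
    let ?F = "\<lambda>y. \<Phi> (T0 x y) - peval to_ac (\<lambda>i. x $ i) c ^ d * \<Phi> x * \<Phi> y"
    have "?F y = 0"
    proof (rule poly_on_lines_vanish[where F = ?F and S = "of_nat ` {..d}"])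
      show "poly_on_lines d ?F"
        by (intro poly_on_lines_diff poly_on_lines_cmult poly_on_lines_comp_linear[OF \<Phi>_poly T0_linear] \<Phi>_poly)
      show "infinite ((of_nat :: nat \<Rightarrow> 'k alg_closure) ` {..d}) \<or>
          d < card ((of_nat :: nat \<Rightarrow> 'k alg_closure) ` {..d})"
        using card_of_nat_small[OF charl] by simp
      fix y :: "('k alg_closure, 'n) vec" assume "\<And>i. y $ i \<in> of_nat ` {..d}"
      then have "\<forall>i. \<exists>e. y $ i = to_ac (of_nat e)" by force
      then obtain e where e: "\<And>i. y $ i = to_ac (of_nat (e i))" by metis
      show "?F y = 0"
        using ac.evaluate_identity[OF id, of "\<lambda>i. of_nat (e i)" "\<lambda>i. x $ i"]
        by (simp add: \<Phi>_def T0_def e del: to_ac_of_nat)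
    qed
    then show ?thesis by simp
  qed
  obtain x0 :: "('k alg_closure, 'n) vec" where x0: "peval to_ac (\<lambda>i. x0 $ i) c \<noteq> 0"
    by (rule peval_nonzero_infinite[OF c _ infinite_UNIV_alg_closed, where h = to_ac]) auto
  obtain e where e: "poly_on_lines e (\<lambda>x::('k alg_closure, 'n) vec. peval to_ac (\<lambda>i. x $ i) c)"
    using ex_poly_on_lines_peval by blast
  show ?thesis
  proof (rule multiplicative_diag_form_dim_1[where a = a and d = d and
        H = "\<lambda>u. peval to_ac (\<lambda>i. g' u $ i) c" and T = "\<lambda>u y. g (T0 (g' u) (g' y))"])
    show "d \<ge> 3" by (rule d)
    show "of_nat d \<noteq> (0 :: 'k alg_closure)" "of_nat (d - 1) \<noteq> (0 :: 'k alg_closure)"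
      by (rule of_nat_small_nonzero[OF charl]; use d in simp)+
    show "a i \<noteq> 0" for i by (rule a)
    show "poly_on_lines e (\<lambda>u. peval to_ac (\<lambda>i. g' u $ i) c)"
      by (rule poly_on_lines_comp_linear[OF e g'])
    show "peval to_ac (\<lambda>i. g' (g x0) $ i) c \<noteq> 0" using x0 by (simp add: g'g)
    show "Vector_Spaces.linear (*s) (*s) (\<lambda>y. g (T0 (g' u) (g' y)))" for u
      using Vector_Spaces.linear_compose[OF Vector_Spaces.linear_compose[OF g' T0_linear] g] by (simp add: o_def)
    show "diag_form d a (g (T0 (g' u) (g' y))) =
        peval to_ac (\<lambda>i. g' u $ i) c ^ d * diag_form d a u * diag_form d a y" for u y
      using mult0[of "g' u" "g' y"] by (simp add: \<Phi>_diag gg')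
    fix y i
    have "g (T0 (g' u) (g' y)) $ i = (\<Sum>k\<in>UNIV. \<Sum>l\<in>UNIV.
        g (axis k 1) $ i * (g' y $ l * peval to_ac (\<lambda>i. g' u $ i) (N k l)))" for u
      by (subst linear_component[OF g]) (simp add: T0_def sum_distrib_left)
    moreover have "\<exists>e. poly_on_lines e (\<lambda>u. \<Sum>k\<in>UNIV. \<Sum>l\<in>UNIV.
        g (axis k 1) $ i * (g' y $ l * peval to_ac (\<lambda>i. g' u $ i) (N k l)))"
    proof (intro ex_poly_on_lines_sum finite)
      fix k l
      obtain e where "poly_on_lines e (\<lambda>x::('k alg_closure, 'n) vec. peval to_ac (\<lambda>i. x $ i) (N k l))"
        using ex_poly_on_lines_peval by blast
      from poly_on_lines_comp_linear[OF this g']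
      show "\<exists>e. poly_on_lines e (\<lambda>u. g (axis k 1) $ i * (g' y $ l * peval to_ac (\<lambda>i. g' u $ i) (N k l)))"
        by (intro exI[of _ e] poly_on_lines_cmult)
    qed
    ultimately show "\<exists>e. poly_on_lines e (\<lambda>u. g (T0 (g' u) (g' y)) $ i)" by simp
  qed
qed

section \<open>One-dimensional strongly multiplicative forms\<close>

text \<open>
  For \<open>\<phi> = A x\<^sup>d\<close> the identity reads \<open>N\<^sup>d A = c\<^sup>d (A X\<^sup>d) A\<close>. Specialization at a point could
  make \<open>c\<close> vanish everywhere if the field is finite, so the identity is read in \<open>'k[X]\<close>, where
  comparing leading coefficients shows that \<open>A\<close> is a \<open>d\<close>-th power.
\<close>

lemma one_dimensional_coefficient_is_power:
  fixes sc :: "'k::field \<Rightarrow> 'v::ab_group_add \<Rightarrow> 'v"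
    and b :: "'n::{finite,linorder} \<Rightarrow> 'v"
  assumes n: "CARD('n) = 1"
    and hom: "homogeneous d (form_poly sc b d \<phi>)"
    and mult: "strongly_multiplicative sc b d \<phi>"
    and nz: "peval (\<lambda>a. a) (\<lambda>_. 1) (form_poly sc b d \<phi>) \<noteq> 0"
  obtains r where "peval (\<lambda>a. a) (\<lambda>_. 1) (form_poly sc b d \<phi>) = r ^ d"
proof -
  define p where "p = form_poly sc b d \<phi>"
  define A where "A = peval (\<lambda>a. a) (\<lambda>_. 1) p"
  obtain i :: 'n where i: "UNIV = {i}" using n by (metis card_1_singletonE)
  then have all: "l = i" for l by auto
  obtain c :: "('n, 'k) mpoly" and N where c: "c \<noteq> 0"
    and id: "\<And>y. peval const_poly (\<lambda>i. \<Sum>l\<in>UNIV. const_poly (y l) * N i l) p =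
      c ^ d * peval const_poly var_poly p * const_poly (peval (\<lambda>a. a) y p)"
    using strongly_multiplicative_identity[OF mult hom] unfolding p_def by blast
  interpret u: unital_ring_hom "\<lambda>a::'k. [:a:]" by unfold_locales simp_all
  define E where "E = peval (\<lambda>a::'k. [:a:]) (\<lambda>_::'n. [:0, 1:])"
  have pure: "peval (\<lambda>a::'k. [:a:]) (\<lambda>_. z) p = z ^ d * [:A:]" for z
    using peval_scale[OF hom, of "\<lambda>a::'k. [:a:]" z "\<lambda>_. 1"] u.hom_peval[of "\<lambda>a. a" "\<lambda>_. 1" p]
    by (simp add: p_def A_def one_pCons)
  have E: "E (N i i) ^ d * [:A:] = E c ^ d * ([:0, 1:] ^ d * [:A:]) * [:A:]"
  proof -
    have "peval (\<lambda>a::'k. [:a:]) (\<lambda>i. \<Sum>l\<in>UNIV. [:1:] * E (N i l)) p = 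
       E c ^ d * peval (\<lambda>a. [:a:]) (\<lambda>_. [:0, 1:]) p * peval (\<lambda>a. [:a:]) (\<lambda>_. [:1:]) p"
      unfolding E_def by (rule u.evaluate_identity[OF id, of "\<lambda>_. 1" "\<lambda>_. [:0, 1:]"])
    moreover have "(\<lambda>i. \<Sum>l\<in>UNIV. [:1:] * E (N i l)) = (\<lambda>_. E (N i i))"
      using all by (auto simp: i fun_eq_iff one_pCons[symmetric]) (metis all)
    ultimately show ?thesis by (simp only: pure) (simp add: one_pCons[symmetric])
  qed
  have "E c \<noteq> 0"
  proof
    assume "E c = 0"
    obtain m where m: "m \<in> Poly_Mapping.keys c"
      using c by (metis poly_mapping_eqI lookup_zero lookup_not_eq_zero_eq_in_keys)
    have "E c = (\<Sum>m\<in>Poly_Mapping.keys c. Polynomial.monom (Poly_Mapping.lookup c m) (Poly_Mapping.lookup m i))"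
      by (simp add: E_def peval_def i monom_altdef)
    moreover have key: "Poly_Mapping.lookup m' i = Poly_Mapping.lookup m i \<longleftrightarrow> m' = m" for m'
      using all by (auto intro!: poly_mapping_eqI) (metis all)
    ultimately have "Polynomial.coeff (E c) (Poly_Mapping.lookup m i) =
        (\<Sum>m'\<in>Poly_Mapping.keys c. if m' = m then Poly_Mapping.lookup c m' else 0)"
      by (simp only: coeff_sum coeff_monom key)
    also have "\<dots> = Poly_Mapping.lookup c m" using m by simp
    finally show False using m \<open>E c = 0\<close> by (simp add: in_keys_iff)
  qed
  have "A \<noteq> 0" using nz by (simp add: A_def p_def)
  from arg_cong[OF E, of Polynomial.lead_coeff]
  have "Polynomial.lead_coeff (E (N i i)) ^ d * A = Polynomial.lead_coeff (E c) ^ d * A * A"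
    by (simp only: lead_coeff_mult lead_coeff_power) simp
  then have "A = (Polynomial.lead_coeff (E (N i i)) / Polynomial.lead_coeff (E c)) ^ d"
    using \<open>A \<noteq> 0\<close> \<open>E c \<noteq> 0\<close> by (simp add: power_divide divide_simps mult_ac)
  then show ?thesis by (intro that) (simp add: A_def p_def)
qed

text \<open>
  Nondegeneracy excludes \<open>\<phi> = 0\<close>. If \<open>\<phi> (z b\<^sub>i) = z\<^sup>d r\<^sup>d\<close>, then \<open>z b\<^sub>i \<mapsto> z r\<close>, with
  \<open>r \<noteq> 0\<close>, is an isomorphism onto \<open>\<langle>1\<rangle>\<close>.
\<close>

lemma one_dimensional_isomorphic_unit_form:
  fixes sc :: "'k::field \<Rightarrow> 'v::ab_group_add \<Rightarrow> 'v"
    and b :: "'n::{finite,linorder} \<Rightarrow> 'v"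
  assumes n: "CARD('n) = 1" and d: "d > 0" and char: "CHAR('k) = 0 \<or> CHAR('k) > d"
    and fd: "finite_dimensional_vector_space sc (range b)" "inj b"
    and form: "is_form sc b d \<phi>" and nondeg: "nondegenerate sc d \<phi>"
    and mult: "strongly_multiplicative sc b d \<phi>"
  shows "isomorphic_forms sc \<phi> (*s) (unit_form d)"
proof -
  interpret fd: finite_dimensional_vector_space sc "range b" by (rule fd)
  interpret pair: vector_space_pair sc "(*s) :: 'k \<Rightarrow> 'k ^ 1 \<Rightarrow> _" ..
  define p where "p = form_poly sc b d \<phi>"
  have p: "homogeneous d p" "in_coords sc b \<phi> = mpoly_eval p"
    unfolding p_def by (rule form_poly[OF char form])+
  define A where "A = peval (\<lambda>a. a) (\<lambda>_. 1) p"
  obtain i :: 'n where i: "UNIV = {i}" using n by (metis card_1_singletonE)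
  have pure: "peval (\<lambda>a. a) (\<lambda>_. z) p = z ^ d * A" for z :: 'k
    using peval_scale[OF p(1), of "\<lambda>a. a" z "\<lambda>_. 1"] by (simp add: A_def)
  interpret idh: unital_ring_hom "\<lambda>a::'k. a" by unfold_locales simp_all
  have "A \<noteq> 0"
  proof
    assume "A = 0"
    have "peval (\<lambda>a. a) (\<lambda>j. x j + t * 1) p = peval (\<lambda>a. a) x p" for x :: "'n \<Rightarrow> 'k" and t
    proof -
      have "x j = x i" for j using i by (metis UNIV_I singletonD)
      then obtain z where x: "x = (\<lambda>_. z)" by blast
      show ?thesis by (simp add: x pure \<open>A = 0\<close>)
    qed
    from nondegenerate_after_extension[OF char char d fd p nondeg idh.unital_ring_hom_axioms this]
    show False by simp
  qed
  then obtain r where r: "A = r ^ d"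
    using one_dimensional_coefficient_is_power[OF n p(1)[unfolded p_def] mult] by (auto simp: A_def p_def)
  then have r0: "r \<noteq> 0" using \<open>A \<noteq> 0\<close> d by auto
  have range: "range b = {b i}" using i by auto
  obtain f :: "'v \<Rightarrow> 'k ^ 1" where lin: "Vector_Spaces.linear sc (*s) f" and fb: "f (b i) = (\<chi> _. r)"
    using pair.linear_independent_extend[OF fd.independent_Basis, of "\<lambda>_. \<chi> _. r"] by (auto simp: range)
  interpret lin: Vector_Spaces.linear sc "(*s)" f by (rule lin)
  have exp: "\<exists>z. v = sc z (b i)" for v
    using fd.span_Basis by (auto simp: range fd.span_singleton)
  have f: "f (sc z (b i)) = (\<chi> _. z * r)" for z by (simp add: lin.scale fb vec_eq_iff)
  have "bij f"
  proof (rule bijI)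
    show "inj f"
    proof (rule injI)
      fix u v assume "f u = f v"
      moreover obtain y z where "u = sc y (b i)" "v = sc z (b i)" using exp by metis
      ultimately show "u = v" using r0 by (simp add: f vec_eq_iff)
    qed
    have "y = f (sc (y $ 1 / r) (b i))" for y using r0 by (simp add: f vec_eq_iff)
    then show "surj f" by (rule surjI[OF sym])
  qed
  moreover have "unit_form d (f v) = \<phi> v" for v
  proof -
    obtain z where z: "v = sc z (b i)" using exp by blast
    have "\<phi> v = in_coords sc b \<phi> (\<chi> _. z)" by (simp add: in_coords_def i z)
    also have "\<dots> = z ^ d * A" by (simp add: p(2) mpoly_eval_peval pure)
    also have "\<dots> = unit_form d (f v)"
      by (simp add: unit_form_def diag_form_def z f r power_mult_distrib UNIV_1)
    finally show ?thesis by simp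
  qed
  ultimately show ?thesis unfolding isomorphic_forms_def using lin by blast
qed

text \<open>
  The matrix of the diagonalizing map also diagonalizes \<open>\<phi>\<close> over the closure, since both sides
  have degree \<open>d\<close> and agree on vectors over \<open>'k\<close>. Hence diagonal forms are covered by the
  separable case.
\<close>

lemma diagonal_imp_diagonal_over_closure:
  fixes sc :: "'k::field \<Rightarrow> 'v::ab_group_add \<Rightarrow> 'v"
    and b :: "'n::{finite,linorder} \<Rightarrow> 'v" and a :: "'n \<Rightarrow> 'k"
  assumes char: "CHAR('k) = 0 \<or> CHAR('k) > d" and form: "is_form sc b d \<phi>"
    and f: "Vector_Spaces.linear sc (*s) f" "\<And>v. diag_form d a (f v) = \<phi> v"
  defines "g \<equiv> \<lambda>x :: ('k alg_closure, 'n) vec. \<chi> i. \<Sum>l\<in>UNIV. x $ l * to_ac (f (b l) $ i)"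
  shows "Vector_Spaces.linear (*s) (*s) g"
    and "peval to_ac (\<lambda>i. x $ i) (form_poly sc b d \<phi>) = diag_form d (\<lambda>i. to_ac (a i)) (g x)"
proof -
  define p where "p = form_poly sc b d \<phi>"
  have p: "homogeneous d p" "in_coords sc b \<phi> = mpoly_eval p"
    unfolding p_def by (rule form_poly[OF char form])+
  have charl: "CHAR('k alg_closure) = 0 \<or> CHAR('k alg_closure) > d" using char by simp
  interpret ac: unital_ring_hom "to_ac :: 'k \<Rightarrow> _" by unfold_locales simp_all
  interpret f: Vector_Spaces.linear sc "(*s)" f by (rule f(1))
  show g: "Vector_Spaces.linear (*s) (*s) g"
    by unfold_locales (simp_all add: g_def vec_eq_iff algebra_simps sum.distrib sum_distrib_left)
  let ?F = "\<lambda>x. peval to_ac (\<lambda>i. x $ i) p - diag_form d (\<lambda>i. to_ac (a i)) (g x)"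
  have "?F x = 0"
  proof (rule poly_on_lines_vanish[where F = ?F and S = "of_nat ` {..d}"])
    have "poly_on_lines d (diag_form d (\<lambda>i. to_ac (a i)))"
      unfolding diag_form_def by (rule poly_on_lines_diag_form)
    moreover have "poly_on_lines d (\<lambda>x::('k alg_closure, 'n) vec. peval to_ac (\<lambda>i. x $ i) p)"
      by (rule poly_on_lines_peval) (use p(1) in \<open>simp add: homogeneous_def\<close>)
    ultimately show "poly_on_lines d ?F"
      by (intro poly_on_lines_diff poly_on_lines_comp_linear[OF _ g])
    show "infinite ((of_nat :: nat \<Rightarrow> 'k alg_closure) ` {..d}) \<or>
        d < card ((of_nat :: nat \<Rightarrow> 'k alg_closure) ` {..d})"
      using card_of_nat_small[OF charl] by simp
    fix x :: "('k alg_closure, 'n) vec" assume "\<And>i. x $ i \<in> of_nat ` {..d}"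
    then have "\<forall>i. \<exists>e. x $ i = to_ac (of_nat e)" by force
    then obtain e where e: "\<And>i. x $ i = to_ac (of_nat (e i))" by metis
    define y :: "('k, 'n) vec" where "y = (\<chi> i. of_nat (e i))"
    have xy: "x $ i = to_ac (y $ i)" for i by (simp add: y_def e)
    have "f (\<Sum>l\<in>UNIV. sc (y $ l) (b l)) $ i = (\<Sum>l\<in>UNIV. y $ l * f (b l) $ i)" for i
      by (simp add: f.sum f.scale)
    then have "diag_form d (\<lambda>i. to_ac (a i)) (g x) =
        to_ac (diag_form d a (f (\<Sum>l\<in>UNIV. sc (y $ l) (b l))))"
      by (simp add: diag_form_def g_def xy to_ac_sum)
    also have "\<dots> = to_ac (in_coords sc b \<phi> y)" by (simp add: f(2) in_coords_def)
    also have "\<dots> = peval to_ac (\<lambda>i. x $ i) p"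
      by (simp add: p(2) mpoly_eval_peval ac.hom_peval xy)
    finally show "?F x = 0" by simp
  qed
  then show "peval to_ac (\<lambda>i. x $ i) (form_poly sc b d \<phi>) = diag_form d (\<lambda>i. to_ac (a i)) (g x)"
    by (simp add: p_def)
qed

theorem theorem2:
  fixes sc :: "'k::field \<Rightarrow> 'v::ab_group_add \<Rightarrow> 'v"
    and b :: "'n::{finite,linorder} \<Rightarrow> 'v"
    and \<phi> :: "'v \<Rightarrow> 'k"
    and d :: nat
  assumes "d \<ge> 3"
    and "CHAR('k) = 0 \<or> CHAR('k) > d"
    and "finite_dimensional_vector_space sc (range b)" and "inj b"
    and "is_form sc b d \<phi>"
    and "nondegenerate sc d \<phi>"
    and "strongly_multiplicative sc b d \<phi>"
  shows "(is_diagonal TYPE('n) sc d \<phi> \<longrightarrow> isomorphic_forms sc \<phi> (*s) (unit_form d)) \<and>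
         (is_separable sc b d \<phi> \<longrightarrow> isomorphic_forms sc \<phi> (*s) (unit_form d))"
proof -
  have unit: "isomorphic_forms sc \<phi> (*s) (unit_form d)"
    if "Vector_Spaces.linear (*s) (*s) g"
      "\<And>x. peval to_ac (\<lambda>i. x $ i) (form_poly sc b d \<phi>) = diag_form d a (g x)"
    for g :: "('k alg_closure, 'n) vec \<Rightarrow> ('k alg_closure, 'n) vec" and a
  proof -
    have "CARD('n) = 1" by (rule diagonal_over_closure_dim_1[OF assms that])
    then show ?thesis
      using assms(1) by (intro one_dimensional_isomorphic_unit_form[OF _ _ assms(2-7)]) auto
  qed
  show ?thesis
  proof (intro conjI impI)
    assume "is_diagonal TYPE('n) sc d \<phi>"
    then obtain a :: "'n \<Rightarrow> 'k" and f where "Vector_Spaces.linear sc (*s) f"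
        "\<And>v. diag_form d a (f v) = \<phi> v"
      unfolding is_diagonal_def isomorphic_forms_def by blast
    from diagonal_imp_diagonal_over_closure[OF assms(2,5) this]
    show "isomorphic_forms sc \<phi> (*s) (unit_form d)" by (rule unit)
  next
    assume "is_separable sc b d \<phi>"
    then obtain a :: "'n \<Rightarrow> 'k alg_closure" and g where "Vector_Spaces.linear (*s) (*s) g"
        and g: "\<And>x. diag_form d a (g x) = base_change to_ac sc b d \<phi> x"
      unfolding is_separable_def is_diagonal_def isomorphic_forms_def by blast
    moreover have "base_change to_ac sc b d \<phi> x = peval to_ac (\<lambda>i. x $ i) (form_poly sc b d \<phi>)" for x
      unfolding base_change_def by (rule mpoly_eval_map) simp
    ultimately show "isomorphic_forms sc \<phi> (*s) (unit_form d)" by (intro unit[of g a]) auto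
  qed
qed

end
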